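(* Let $\acute N$ be a radical screen transversal lightlike submanifold of a locally metallic semi-Riemannian manifold $(\breve N,\breve g,\breve J)$. Then the radical distribution $Rad(T\acute N)$ defines a totally geodesic foliation if and only if one of the following holds: (i) $A_{\breve JU}W\in\Gamma(Rad(T\acute N))$ and $A^{*}_UW=0$ for all $W,U\in\Gamma(Rad(T\acute N))$; (ii) $A_{\breve JU}W=p\,A^{*}_UW$ for all $W,U\in\Gamma(Rad(T\acute N))$; (iii) there is no component of $h^s(W,\breve JZ)$ in $\breve J\,Rad(T\acute N)$ for all $W\in\Gamma(Rad(T\acute N))$ and $Z\in\Gamma(S(T\acute N))$.
   Context: Fix positive integers $p,q$. A metallic semi-Riemannian manifold $(\breve N,\breve g,\breve J)$ is a semi-Riemannian manifold $(\breve N,\breve g)$ with a $(1,1)$-tensor field $\breve J$ such that $\breve J^2=p\breve J+qI$ and $\breve g(\breve JW,U)=\breve g(W,\breve JU)$ for all vector fields $W,U$ on $\breve N$. It is locally metallic if $\breve\nabla\breve J=0$, where $\breve\nabla$ is the Levi-Civita connection of $\breve g$. A submanifold $\acute N$ of dimension $m$ in $\breve N$ is lightlike if the metric $g$ induced from $\breve g$ is degenerate and $Rad(T\acute N)=T\acute N\cap T\acute N^{\perp}$ is a distribution of constant rank $r$, $1\le r\le m$. Fix a screen distribution $S(T\acute N)$ (non-degenerate complement of $Rad(T\acute N)$ in $T\acute N$), a screen transversal bundle $S(T\acute N^{\perp})$ (non-degenerate complement of $Rad(T\acute N)$ in $T\acute N^{\perp}$), and the associated lightlike transversal bundle $ltr(T\acute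 N)$: it is orthogonal to $S(T\acute N)$ and $S(T\acute N^\perp)$, and for any local basis $\{\xi_i\}$ of $Rad(T\acute N)$ it is locally spanned by $\{N_i\}$ with $\breve g(\xi_i,N_j)=\delta_{ij}$, $\breve g(N_i,N_j)=0$. With $\oplus_{ort}$ denoting orthogonal direct sum, $T\breve N|_{\acute N}=S(T\acute N)\oplus_{ort}[Rad(T\acute N)\oplus ltr(T\acute N)]\oplus_{ort}S(T\acute N^{\perp})$. For $W,U\in\Gamma(T\acute N)$ and $Z\in\Gamma(S(T\acute N^\perp))$ write $\breve\nabla_WU=\nabla_WU+h^{\ell}(W,U)+h^s(W,U)$ and $\breve\nabla_WZ=-A_ZW+\nabla^s_WZ+D^{\ell}(W,Z)$, where $\nabla_WU,A_ZW\in\Gamma(T\acute N)$, $h^\ell(W,U),D^\ell(W,Z)\in\Gamma(ltr(T\acute N))$ and $h^s(W,U),\nabla^s_WZ\in\Gamma(S(T\acute N^\perp))$. For $W\in\Gamma(T\acute N)$ and $\xi\in\Gamma(Rad(T\acute N))$ write $\nabla_W\xi=-A^{*}_{\xi}W+\nabla^{*t}_W\xi$ with $A^{*}_\xi W\in\Gamma(S(T\acute N))$ and $\nabla^{*t}_W\xi\in\Gamma(Rad(T\acute N))$. The radical distribution defines a totally geodesic foliation if $\nabla_WU\in\Gamma(Rad(T\acute N))$ for all $W,U\in\Gamma(Rad(T\acute N))$, equivalently $g(\nabla_WU,Z)=0$ for all such $W,U$ and all $Z\in\Gamma(S(T\acute N))$. $\acute N$ is radical screen transversal if $\breve J\,Rad(T\acute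 N)\subset S(T\acute N^{\perp})$ and $\breve J\,S(T\acute N)=S(T\acute N)$. A section $X$ is said to have no component in $\breve J\,Rad(T\acute N)$ if $\breve g(X,\breve JU)=0$ for all $U\in\Gamma(Rad(T\acute N))$. *)

theory Defs
  imports "HOL-Analysis.Analysis"
begin

section \<open>Smooth manifolds\<close>

text \<open>For open \<open>S\<close>: all iterated directional derivatives up to order \<open>n\<close> exist and are continuous.\<close>

fun Ck_on :: "nat \<Rightarrow> 'a::real_normed_vector set \<Rightarrow> ('a \<Rightarrow> 'b::real_normed_vector) \<Rightarrow> bool" where
  "Ck_on 0 S f \<longleftrightarrow> continuous_on S f"
| "Ck_on (Suc n) S f \<longleftrightarrow> (\<forall>x\<in>S. f differentiable (at x)) \<and>
     (\<forall>v. Ck_on n S (\<lambda>x. frechet_derivative f (at x) v))"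

definition smooth_on :: "'a::real_normed_vector set \<Rightarrow> ('a \<Rightarrow> 'b::real_normed_vector) \<Rightarrow> bool" where
  "smooth_on S f \<longleftrightarrow> (\<forall>n. Ck_on n S f)"

text \<open>A manifold is a type of points (Hausdorff and second countable) with a smooth atlas; a chart
  is its domain together with its coordinate map.\<close>

type_synonym ('m, 'e) chart = "'m set \<times> ('m \<Rightarrow> 'e)"

abbreviation chart_inv :: "('m, 'e) chart \<Rightarrow> 'e \<Rightarrow> 'm" where
  "chart_inv c \<equiv> inv_into (fst c) (snd c)"

definition smooth_atlas ::
  "('m::{t2_space,second_countable_topology}, 'e::euclidean_space) chart set \<Rightarrow> bool" where
  "smooth_atlas A \<longleftrightarrow>
     (\<Union>c\<in>A. fst c) = UNIV \<and>
     (\<forall>c\<in>A. open (fst c) \<and> open (snd c ` fst c) \<and>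
        homeomorphism (fst c) (snd c ` fst c) (snd c) (chart_inv c)) \<and>
     (\<forall>c\<in>A. \<forall>d\<in>A. smooth_on (snd c ` (fst c \<inter> fst d)) (snd d \<circ> chart_inv c))"

text \<open>Every point \<open>x\<close> has a preferred chart. The tangent space at \<open>x\<close> is the model space \<open>'e\<close>, where a
  tangent vector is represented by its components in the preferred chart at \<open>x\<close>.\<close>

definition chart_at :: "('m, 'e) chart set \<Rightarrow> 'm \<Rightarrow> ('m, 'e) chart" where
  "chart_at A x = (SOME c. c \<in> A \<and> x \<in> fst c)"

definition smooth_fun_on ::
  "('m::topological_space, 'e::euclidean_space) chart set \<Rightarrow> 'm set
    \<Rightarrow> ('m \<Rightarrow> 'b::real_normed_vector) \<Rightarrow> bool" where
  "smooth_fun_on A U f \<longleftrightarrow> (\<forall>c\<in>A. smooth_on (snd c ` (fst c \<inter> U)) (f \<circ> chart_inv c))"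

text \<open>\<open>differential A f x v\<close> is the derivative of the vector-valued function \<open>f\<close> in the direction of the
  tangent vector \<open>v\<close> at \<open>x\<close>. With \<open>f\<close> the coordinate map of an arbitrary chart around \<open>x\<close>, it gives the
  components of \<open>v\<close> in that chart.\<close>

definition differential ::
  "('m, 'e::euclidean_space) chart set \<Rightarrow> ('m \<Rightarrow> 'b::real_normed_vector) \<Rightarrow> 'm \<Rightarrow> 'e \<Rightarrow> 'b" where
  "differential A f x v =
     frechet_derivative (f \<circ> chart_inv (chart_at A x)) (at (snd (chart_at A x) x)) v"

definition smooth_map ::
  "('n::topological_space, 'k::euclidean_space) chart set
    \<Rightarrow> ('m::topological_space, 'e::euclidean_space) chart set \<Rightarrow> ('n \<Rightarrow> 'm) \<Rightarrow> bool" where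
  "smooth_map B A \<iota> \<longleftrightarrow> continuous_on UNIV \<iota> \<and>
     (\<forall>c\<in>A. smooth_fun_on B (\<iota> -` fst c) (snd c \<circ> \<iota>))"

definition pushforward ::
  "('n, 'k::euclidean_space) chart set \<Rightarrow> ('m, 'e::euclidean_space) chart set
    \<Rightarrow> ('n \<Rightarrow> 'm) \<Rightarrow> 'n \<Rightarrow> 'k \<Rightarrow> 'e" where
  "pushforward B A \<iota> x = differential B (snd (chart_at A (\<iota> x)) \<circ> \<iota>) x"

text \<open>Vector fields along \<open>\<iota>\<close>, i.e. sections of the pullback of the tangent bundle by \<open>\<iota>\<close>: the value
  \<open>V x\<close> is a tangent vector at \<open>\<iota> x\<close>. Ordinary vector fields are the case \<open>\<iota> = id\<close>.\<close>

definition smooth_along ::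
  "('n::topological_space, 'k::euclidean_space) chart set
    \<Rightarrow> ('m::topological_space, 'e::euclidean_space) chart set
    \<Rightarrow> ('n \<Rightarrow> 'm) \<Rightarrow> 'n set \<Rightarrow> ('n \<Rightarrow> 'e) \<Rightarrow> bool" where
  "smooth_along B A \<iota> U V \<longleftrightarrow>
     (\<forall>c\<in>A. smooth_fun_on B (U \<inter> \<iota> -` fst c) (\<lambda>x. differential A (snd c) (\<iota> x) (V x)))"

definition smooth_field_on ::
  "('m::topological_space, 'e::euclidean_space) chart set \<Rightarrow> 'm set \<Rightarrow> ('m \<Rightarrow> 'e) \<Rightarrow> bool" where
  "smooth_field_on A U X \<longleftrightarrow> smooth_along A A id U X"

definition smooth_fun_near ::
  "('m::topological_space, 'e::euclidean_space) chart set \<Rightarrow> 'm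
    \<Rightarrow> ('m \<Rightarrow> 'b::real_normed_vector) \<Rightarrow> bool" where
  "smooth_fun_near A x f \<longleftrightarrow> (\<exists>U. open U \<and> x \<in> U \<and> smooth_fun_on A U f)"

definition smooth_field_near ::
  "('m::topological_space, 'e::euclidean_space) chart set \<Rightarrow> 'm \<Rightarrow> ('m \<Rightarrow> 'e) \<Rightarrow> bool" where
  "smooth_field_near A x X \<longleftrightarrow> (\<exists>U. open U \<and> x \<in> U \<and> smooth_field_on A U X)"

section \<open>Metallic semi-Riemannian manifolds\<close>

definition nondegenerate_on :: "('e::real_vector \<Rightarrow> 'e \<Rightarrow> real) \<Rightarrow> 'e set \<Rightarrow> bool" where
  "nondegenerate_on b E \<longleftrightarrow> (\<forall>v\<in>E. (\<forall>w\<in>E. b v w = 0) \<longrightarrow> v = 0)"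

definition metric_index :: "('e::euclidean_space \<Rightarrow> 'e \<Rightarrow> real) \<Rightarrow> nat" where
  "metric_index b = Max {dim V | V. 
     subspace V \<and> (\<forall>v\<in>V. v \<noteq> 0 \<longrightarrow> b v v < 0)}"

definition semi_riemannian ::
  "('m::{t2_space,second_countable_topology}, 'e::euclidean_space) chart set
    \<Rightarrow> ('m \<Rightarrow> 'e \<Rightarrow> 'e \<Rightarrow> real) \<Rightarrow> bool" where
  "semi_riemannian A g \<longleftrightarrow> smooth_atlas A \<and>
     (\<forall>x. bilinear (g x) \<and> (\<forall>v w. g x v w = g x w v) \<and> nondegenerate_on (g x) UNIV) \<and>
     (\<forall>U X Y. open U \<longrightarrow> smooth_field_on A U X \<longrightarrow> smooth_field_on A U Y \<longrightarrow>
        smooth_fun_on A U (\<lambda>x. g x (X x) (Y x))) \<and>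
     (\<exists>\<nu>. \<forall>x. metric_index (g x) = \<nu>)"

definition metallic_semi_riemannian ::
  "nat \<Rightarrow> nat \<Rightarrow> ('m::{t2_space,second_countable_topology}, 'e::euclidean_space) chart set
    \<Rightarrow> ('m \<Rightarrow> 'e \<Rightarrow> 'e \<Rightarrow> real) \<Rightarrow> ('m \<Rightarrow> 'e \<Rightarrow> 'e) \<Rightarrow> bool" where
  "metallic_semi_riemannian p q A g J \<longleftrightarrow> semi_riemannian A g \<and>
     (\<forall>x. linear (J x)) \<and>
     (\<forall>U X. open U \<longrightarrow> smooth_field_on A U X \<longrightarrow> smooth_field_on A U (\<lambda>x. J x (X x))) \<and>
     (\<forall>x v. J x (J x v) = real p *\<^sub>R J x v + real q *\<^sub>R v) \<and>
     (\<forall>x v w. g x (J x v) w = g x v (J x w))"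

text \<open>\<open>nab x v Y\<close> is the covariant derivative at \<open>x\<close> of the field \<open>Y\<close> in the direction \<open>v\<close>. As usual a
  connection also acts on fields defined near \<open>x\<close> only, and its axioms are imposed for these; on
  fields that are not smooth near \<open>x\<close> the value is irrelevant.\<close>

definition affine_connection ::
  "('m::topological_space, 'e::euclidean_space) chart set
    \<Rightarrow> ('m \<Rightarrow> 'e \<Rightarrow> ('m \<Rightarrow> 'e) \<Rightarrow> 'e) \<Rightarrow> bool" where
  "affine_connection A nab \<longleftrightarrow>
     (\<forall>x Y. smooth_field_near A x Y \<longrightarrow> linear (\<lambda>v. nab x v Y)) \<and>
     (\<forall>x v Y Z. smooth_field_near A x Y \<longrightarrow> smooth_field_near A x Z \<longrightarrow>
        nab x v (\<lambda>y. Y y + Z y) = nab x v Y + nab x v Z) \<and>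
     (\<forall>x v f Y. smooth_fun_near A x f \<longrightarrow> smooth_field_near A x Y \<longrightarrow>
        nab x v (\<lambda>y. f y *\<^sub>R Y y) = differential A f x v *\<^sub>R Y x + f x *\<^sub>R nab x v Y) \<and>
     (\<forall>U X Y. open U \<longrightarrow> smooth_field_on A U X \<longrightarrow> smooth_field_on A U Y \<longrightarrow>
        smooth_field_on A U (\<lambda>x. nab x (X x) Y))"

text \<open>Torsion-freeness is expressed by the action of the bracket \<open>[X,Y]\<close> on smooth functions \<open>f\<close>.\<close>

definition levi_civita ::
  "('m::topological_space, 'e::euclidean_space) chart set \<Rightarrow> ('m \<Rightarrow> 'e \<Rightarrow> 'e \<Rightarrow> real)
    \<Rightarrow> ('m \<Rightarrow> 'e \<Rightarrow> ('m \<Rightarrow> 'e) \<Rightarrow> 'e) \<Rightarrow> bool" where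
  "levi_civita A g nab \<longleftrightarrow> affine_connection A nab \<and>
     (\<forall>x X Y (f :: 'm \<Rightarrow> real).
        smooth_field_near A x X \<longrightarrow> smooth_field_near A x Y \<longrightarrow> smooth_fun_near A x f \<longrightarrow>
        differential A f x (nab x (X x) Y - nab x (Y x) X) =
          differential A (\<lambda>y. differential A f y (Y y)) x (X x)
          - differential A (\<lambda>y. differential A f y (X y)) x (Y x)) \<and>
     (\<forall>x v Y Z. smooth_field_near A x Y \<longrightarrow> smooth_field_near A x Z \<longrightarrow>
        differential A (\<lambda>y. g y (Y y) (Z y)) x v = g x (nab x v Y) (Z x) + g x (Y x) (nab x v Z))"

definition locally_metallic ::
  "nat \<Rightarrow> nat \<Rightarrow> ('m::{t2_space,second_countable_topology}, 'e::euclidean_space) chart set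
    \<Rightarrow> ('m \<Rightarrow> 'e \<Rightarrow> 'e \<Rightarrow> real) \<Rightarrow> ('m \<Rightarrow> 'e \<Rightarrow> 'e) \<Rightarrow> ('m \<Rightarrow> 'e \<Rightarrow> ('m \<Rightarrow> 'e) \<Rightarrow> 'e) \<Rightarrow> bool" where
  "locally_metallic p q A g J nab \<longleftrightarrow>
     metallic_semi_riemannian p q A g J \<and> levi_civita A g nab \<and>
     (\<forall>x v Y. smooth_field_near A x Y \<longrightarrow> nab x v (\<lambda>y. J y (Y y)) - J x (nab x v Y) = 0)"

section \<open>Lightlike submanifolds\<close>

text \<open>A submanifold is an injective immersion \<open>\<iota>\<close>. All bundles over it are subbundles of the pullback
  of the ambient tangent bundle; tangent vectors of the submanifold are identified with their
  images under the pushforward.\<close>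

definition submanifold ::
  "('n::{t2_space,second_countable_topology}, 'k::euclidean_space) chart set
    \<Rightarrow> ('m::{t2_space,second_countable_topology}, 'e::euclidean_space) chart set
    \<Rightarrow> ('n \<Rightarrow> 'm) \<Rightarrow> bool" where
  "submanifold B A \<iota> \<longleftrightarrow> smooth_atlas B \<and> smooth_atlas A \<and> smooth_map B A \<iota> \<and> inj \<iota> \<and>
     (\<forall>x. inj (pushforward B A \<iota> x))"

definition tangent_space ::
  "('n, 'k::euclidean_space) chart set \<Rightarrow> ('m, 'e::euclidean_space) chart set
    \<Rightarrow> ('n \<Rightarrow> 'm) \<Rightarrow> 'n \<Rightarrow> 'e set" where
  "tangent_space B A \<iota> x = range (pushforward B A \<iota> x)"

definition normal_space ::
  "('n, 'k::euclidean_space) chart set \<Rightarrow> ('m, 'e::euclidean_space) chart set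
    \<Rightarrow> ('n \<Rightarrow> 'm) \<Rightarrow> ('m \<Rightarrow> 'e \<Rightarrow> 'e \<Rightarrow> real) \<Rightarrow> 'n \<Rightarrow> 'e set" where
  "normal_space B A \<iota> g x = {v. \<forall>w\<in>tangent_space B A \<iota> x. g (\<iota> x) v w = 0}"

definition radical_space ::
  "('n, 'k::euclidean_space) chart set \<Rightarrow> ('m, 'e::euclidean_space) chart set
    \<Rightarrow> ('n \<Rightarrow> 'm) \<Rightarrow> ('m \<Rightarrow> 'e \<Rightarrow> 'e \<Rightarrow> real) \<Rightarrow> 'n \<Rightarrow> 'e set" where
  "radical_space B A \<iota> g x = tangent_space B A \<iota> x \<inter> normal_space B A \<iota> g x"

definition local_frame ::
  "('n::topological_space, 'k::euclidean_space) chart set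
    \<Rightarrow> ('m::topological_space, 'e::euclidean_space) chart set \<Rightarrow> ('n \<Rightarrow> 'm)
    \<Rightarrow> nat \<Rightarrow> ('n \<Rightarrow> 'e set) \<Rightarrow> 'n set \<Rightarrow> (nat \<Rightarrow> 'n \<Rightarrow> 'e) \<Rightarrow> bool" where
  "local_frame B A \<iota> r E U s \<longleftrightarrow> open U \<and> (\<forall>i<r. smooth_along B A \<iota> U (s i)) \<and>
     (\<forall>x\<in>U. inj_on (\<lambda>i. s i x) {..<r} \<and> independent ((\<lambda>i. s i x) ` {..<r}) \<and>
        span ((\<lambda>i. s i x) ` {..<r}) = E x)"

definition subbundle ::
  "('n::topological_space, 'k::euclidean_space) chart set
    \<Rightarrow> ('m::topological_space, 'e::euclidean_space) chart set \<Rightarrow> ('n \<Rightarrow> 'm)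
    \<Rightarrow> nat \<Rightarrow> ('n \<Rightarrow> 'e set) \<Rightarrow> bool" where
  "subbundle B A \<iota> r E \<longleftrightarrow> (\<forall>x. \<exists>U s. x \<in> U \<and> local_frame B A \<iota> r E U s)"

definition sections ::
  "('n::topological_space, 'k::euclidean_space) chart set
    \<Rightarrow> ('m::topological_space, 'e::euclidean_space) chart set \<Rightarrow> ('n \<Rightarrow> 'm)
    \<Rightarrow> ('n \<Rightarrow> 'e set) \<Rightarrow> ('n \<Rightarrow> 'e) set" where
  "sections B A \<iota> E = {V. smooth_along B A \<iota> UNIV V \<and> (\<forall>x. V x \<in> E x)}"

text \<open>\<open>S\<close>, \<open>Str\<close> and \<open>Ltr\<close> are the screen distribution, the screen transversal bundle and the
  lightlike transversal bundle. The induced metric is degenerate since \<open>r \<ge> 1\<close>.\<close>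

definition lightlike_submanifold ::
  "('n::{t2_space,second_countable_topology}, 'k::euclidean_space) chart set
    \<Rightarrow> ('m::{t2_space,second_countable_topology}, 'e::euclidean_space) chart set
    \<Rightarrow> ('n \<Rightarrow> 'm) \<Rightarrow> ('m \<Rightarrow> 'e \<Rightarrow> 'e \<Rightarrow> real) \<Rightarrow> nat
    \<Rightarrow> ('n \<Rightarrow> 'e set) \<Rightarrow> ('n \<Rightarrow> 'e set) \<Rightarrow> ('n \<Rightarrow> 'e set) \<Rightarrow> bool" where
  "lightlike_submanifold B A \<iota> g r S Str Ltr \<longleftrightarrow>
     submanifold B A \<iota> \<and>
     1 \<le> r \<and> r \<le> DIM('k) \<and> subbundle B A \<iota> r (radical_space B A \<iota> g) \<and>
     subbundle B A \<iota> (DIM('k) - r) S \<and>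
     (\<forall>x. nondegenerate_on (g (\<iota> x)) (S x) \<and> radical_space B A \<iota> g x \<inter> S x = {0} \<and>
        span (radical_space B A \<iota> g x \<union> S x) = tangent_space B A \<iota> x) \<and>
     subbundle B A \<iota> (DIM('e) - DIM('k) - r) Str \<and>
     (\<forall>x. nondegenerate_on (g (\<iota> x)) (Str x) \<and> radical_space B A \<iota> g x \<inter> Str x = {0} \<and>
        span (radical_space B A \<iota> g x \<union> Str x) = normal_space B A \<iota> g x) \<and>
     subbundle B A \<iota> r Ltr \<and>
     (\<forall>x. \<forall>v\<in>Ltr x. \<forall>w\<in>S x \<union> Str x. g (\<iota> x) v w = 0) \<and>
     (\<forall>U \<xi>. local_frame B A \<iota> r (radical_space B A \<iota> g) U \<xi> \<longrightarrow>
        (\<exists>N. local_frame B A \<iota> r Ltr U N \<and>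
          (\<forall>x\<in>U. \<forall>i<r. \<forall>j<r. g (\<iota> x) (\<xi> i x) (N j x) = (if i = j then 1 else 0) \<and>
             g (\<iota> x) (N i x) (N j x) = 0)))"

definition radical_screen_transversal ::
  "('n, 'k::euclidean_space) chart set \<Rightarrow> ('m, 'e::euclidean_space) chart set
    \<Rightarrow> ('n \<Rightarrow> 'm) \<Rightarrow> ('m \<Rightarrow> 'e \<Rightarrow> 'e \<Rightarrow> real) \<Rightarrow> ('m \<Rightarrow> 'e \<Rightarrow> 'e)
    \<Rightarrow> ('n \<Rightarrow> 'e set) \<Rightarrow> ('n \<Rightarrow> 'e set) \<Rightarrow> bool" where
  "radical_screen_transversal B A \<iota> g J S Str \<longleftrightarrow>
     (\<forall>x. J (\<iota> x) ` radical_space B A \<iota> g x \<subseteq> Str x \<and> J (\<iota> x) ` S x = S x)"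

section \<open>Induced geometric objects\<close>

text \<open>The field whose components in the chart \<open>c\<close> are constantly \<open>b\<close> (on the domain of \<open>c\<close>).\<close>

definition coordinate_field ::
  "('m, 'e::euclidean_space) chart set \<Rightarrow> ('m, 'e) chart \<Rightarrow> 'e \<Rightarrow> 'm \<Rightarrow> 'e" where
  "coordinate_field A c b y = frechet_derivative (snd (chart_at A y) \<circ> chart_inv c) (at (snd c y)) b"

text \<open>The derivative at \<open>x\<close> of a field \<open>V\<close> along \<open>\<iota>\<close> in the direction \<open>w\<close>, a tangent vector of the
  submanifold at \<open>x\<close>. If \<open>V\<close> has components \<open>V\<^sup>b\<close> with respect to the coordinate fields \<open>E\<^sub>b\<close> of the
  preferred chart \<open>c\<close> at \<open>\<iota> x\<close>, it is the sum over \<open>b\<close> of \<open>w(V\<^sup>b) E\<^sub>b + V\<^sup>b(x) \<nabla>\<^sub>w E\<^sub>b\<close>. (At \<open>\<iota> x\<close> itself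
  \<open>E\<^sub>b\<close> is represented by \<open>b\<close>.) This is the value obtained from any local extension of \<open>V\<close> to
  the ambient manifold.\<close>

definition connection_along ::
  "('n, 'k::euclidean_space) chart set \<Rightarrow> ('m, 'e::euclidean_space) chart set \<Rightarrow> ('n \<Rightarrow> 'm)
    \<Rightarrow> ('m \<Rightarrow> 'e \<Rightarrow> ('m \<Rightarrow> 'e) \<Rightarrow> 'e) \<Rightarrow> 'n \<Rightarrow> 'k \<Rightarrow> ('n \<Rightarrow> 'e) \<Rightarrow> 'e" where
  "connection_along B A \<iota> nab x w V =
     (let c = chart_at A (\<iota> x);
          comps = (\<lambda>y. differential A (snd c) (\<iota> y) (V y))
      in differential B comps x w +
         (\<Sum>b\<in>Basis. (comps x \<bullet> b) *\<^sub>R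
            nab (\<iota> x) (pushforward B A \<iota> x w) (coordinate_field A c b)))"

text \<open>Here \<open>W\<close> is a section of the tangent bundle of the submanifold.\<close>

definition ambient_deriv ::
  "('n, 'k::euclidean_space) chart set \<Rightarrow> ('m, 'e::euclidean_space) chart set \<Rightarrow> ('n \<Rightarrow> 'm)
    \<Rightarrow> ('m \<Rightarrow> 'e \<Rightarrow> ('m \<Rightarrow> 'e) \<Rightarrow> 'e) \<Rightarrow> ('n \<Rightarrow> 'e) \<Rightarrow> ('n \<Rightarrow> 'e) \<Rightarrow> 'n \<Rightarrow> 'e" where
  "ambient_deriv B A \<iota> nab W V x =
     connection_along B A \<iota> nab x (inv (pushforward B A \<iota> x) (W x)) V"

text \<open>The component in \<open>E\<close> of a vector of the direct sum of \<open>E\<close> and \<open>F\<close>.\<close>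

definition component :: "'e::real_vector set \<Rightarrow> 'e set \<Rightarrow> 'e \<Rightarrow> 'e" where
  "component E F v = (THE a. a \<in> E \<and> v - a \<in> F)"

context
  fixes B :: "('n, 'k::euclidean_space) chart set"
    and A :: "('m, 'e::euclidean_space) chart set"
    and \<iota> :: "'n \<Rightarrow> 'm"
    and g :: "'m \<Rightarrow> 'e \<Rightarrow> 'e \<Rightarrow> real"
    and nab :: "'m \<Rightarrow> 'e \<Rightarrow> ('m \<Rightarrow> 'e) \<Rightarrow> 'e"
    and S Str Ltr :: "'n \<Rightarrow> 'e set"
begin

definition induced_connection :: "('n \<Rightarrow> 'e) \<Rightarrow> ('n \<Rightarrow> 'e) \<Rightarrow> 'n \<Rightarrow> 'e" where
  "induced_connection W U x =
     component (tangent_space B A \<iota> x) (span (Ltr x \<union> Str x)) (ambient_deriv B A \<iota> nab W U x)"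

definition screen_second_ff :: "('n \<Rightarrow> 'e) \<Rightarrow> ('n \<Rightarrow> 'e) \<Rightarrow> 'n \<Rightarrow> 'e" where
  "screen_second_ff W U x =
     component (Str x) (span (tangent_space B A \<iota> x \<union> Ltr x)) (ambient_deriv B A \<iota> nab W U x)"

text \<open>\<open>shape_op Z W\<close> is \<open>A\<^sub>Z W\<close>, and \<open>radical_shape_op \<xi> W\<close> is \<open>A\<^sup>*\<^sub>\<xi> W\<close>.\<close>

definition shape_op :: "('n \<Rightarrow> 'e) \<Rightarrow> ('n \<Rightarrow> 'e) \<Rightarrow> 'n \<Rightarrow> 'e" where
  "shape_op Z W x =
     - component (tangent_space B A \<iota> x) (span (Ltr x \<union> Str x)) (ambient_deriv B A \<iota> nab W Z x)"

definition radical_shape_op :: "('n \<Rightarrow> 'e) \<Rightarrow> ('n \<Rightarrow> 'e) \<Rightarrow> 'n \<Rightarrow> 'e" where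
  "radical_shape_op \<xi> W x =
     - component (S x) (radical_space B A \<iota> g x) (induced_connection W \<xi> x)"

end

text \<open>\<open>\<nabla>\<^sub>W U\<close> is a smooth section of the tangent bundle, so being a section of the radical distribution is
  a pointwise condition.\<close>

definition radical_totally_geodesic ::
  "('n::topological_space, 'k::euclidean_space) chart set
    \<Rightarrow> ('m::topological_space, 'e::euclidean_space) chart set \<Rightarrow> ('n \<Rightarrow> 'm)
    \<Rightarrow> ('m \<Rightarrow> 'e \<Rightarrow> 'e \<Rightarrow> real) \<Rightarrow> ('m \<Rightarrow> 'e \<Rightarrow> ('m \<Rightarrow> 'e) \<Rightarrow> 'e)
    \<Rightarrow> ('n \<Rightarrow> 'e set) \<Rightarrow> ('n \<Rightarrow> 'e set) \<Rightarrow> bool" where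
  "radical_totally_geodesic B A \<iota> g nab Str Ltr \<longleftrightarrow>
     (\<forall>W\<in>sections B A \<iota> (radical_space B A \<iota> g). \<forall>U\<in>sections B A \<iota> (radical_space B A \<iota> g).
        \<forall>x. induced_connection B A \<iota> nab Str Ltr W U x \<in> radical_space B A \<iota> g x)"

text \<open>\<open>X\<close> has no component in the image of the radical distribution under \<open>J\<close>.\<close>

definition no_component_in_J_radical ::
  "('n::topological_space, 'k::euclidean_space) chart set
    \<Rightarrow> ('m::topological_space, 'e::euclidean_space) chart set \<Rightarrow> ('n \<Rightarrow> 'm)
    \<Rightarrow> ('m \<Rightarrow> 'e \<Rightarrow> 'e \<Rightarrow> real) \<Rightarrow> ('m \<Rightarrow> 'e \<Rightarrow> 'e) \<Rightarrow> ('n \<Rightarrow> 'e) \<Rightarrow> bool" where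
  "no_component_in_J_radical B A \<iota> g J X \<longleftrightarrow>
     (\<forall>U\<in>sections B A \<iota> (radical_space B A \<iota> g). \<forall>x. g (\<iota> x) (X x) (J (\<iota> x) (U x)) = 0)"

end

theory Submission
  imports Defs
begin

text \<open>Let \<open>D\<^sub>W\<close> be the ambient derivative along the submanifold. For \<open>W\<close>, \<open>U\<close> in the radical, all conditions of
  the theorem are conditions on the products of \<open>D\<^sub>W U\<close> with the screen distribution \<open>S\<close>.

  The two transversal bundles are orthogonal to \<open>S\<close>, so \<open>g (\<nabla>\<^sub>W U) z = g (D\<^sub>W U) z\<close> for \<open>z\<close> in \<open>S\<close>, and a tangent
  vector is radical iff it is orthogonal to \<open>S\<close>. Hence the radical distribution is totally geodesic iff
  \<open>g (D\<^sub>W U) z = 0\<close> for all \<open>z\<close> in \<open>S\<close>, which is also the condition \<open>A\<^sup>*\<^sub>U W = 0\<close>. As \<open>J\<close> is parallel and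
  self-adjoint, \<open>g (A\<^bsub>JU\<^esub> W) z = - g (D\<^sub>W U) (J z)\<close>, and \<open>J\<close> maps \<open>S\<close> onto itself. Therefore being totally
  geodesic is equivalent to (i). Condition (ii) gives \<open>g (D\<^sub>W U) (J z - p z) = 0\<close>; for \<open>z = J y\<close> this is
  \<open>q g (D\<^sub>W U) y = 0\<close>, so that (ii) implies total geodesy. Finally, \<open>JZ\<close> and \<open>JU\<close> are orthogonal, being a tangent
  and a normal field, so the metric property of the connection gives
  \<open>g (h\<^sup>s(W, JZ)) (JU) = g (D\<^sub>W (JZ)) (JU) = - g (JZ) (J D\<^sub>W U) = - g (D\<^sub>W U) (J\<^sup>2 Z)\<close>, and
  (iii) implies total geodesy because \<open>J\<^sup>2\<close> maps \<open>S\<close> onto itself.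

  Three ingredients carry the argument. The derivative of fields along the immersion commutes with \<open>J\<close> and is
  compatible with the metric (\<open>connection_along_parallel\<close>, \<open>connection_along_orthogonal\<close>); both are
  computed with coordinate fields, using that a connection is local. The four bundles split the ambient
  tangent space, so that the components are determined by products with the metric
  (locale \<open>lightlike_splitting\<close>). And every vector of \<open>S\<close> extends to a global section of \<open>S\<close>, by means of a
  bump function (\<open>section_through_vector\<close>); this is needed since (iii) speaks of global sections.\<close>

section \<open>Calculus of smooth maps between normed spaces\<close>

lemma Ck_on_subset: "Ck_on n S f \<Longrightarrow> T \<subseteq> S \<Longrightarrow> Ck_on n T f"
  by (induction n arbitrary: f) (auto intro: continuous_on_subset)

lemma Ck_on_continuous: "Ck_on n S f \<Longrightarrow> continuous_on S f"
  by (cases n) (auto simp: differentiable_imp_continuous_within continuous_at_imp_continuous_on)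

lemma Ck_on_SucD: "Ck_on (Suc n) S f \<Longrightarrow> Ck_on n S f"
proof (induction n arbitrary: f)
  case 0
  then show ?case using Ck_on_continuous by fastforce
qed auto

lemma Ck_on_cong:
  assumes "open S" "\<And>x. x \<in> S \<Longrightarrow> f x = g x"
  shows "Ck_on n S f \<longleftrightarrow> Ck_on n S g"
proof -
  have aux: "Ck_on n S g" if "Ck_on n S f" "\<And>x. x \<in> S \<Longrightarrow> f x = g x" for f g :: "'a \<Rightarrow> 'b"
    using that
  proof (induction n arbitrary: f g)
    case 0
    then show ?case using continuous_on_cong by fastforce
  next
    case (Suc n)
    have D: "(g has_derivative frechet_derivative f (at x)) (at x)" if "x \<in> S" for x
    proof -
      have "(f has_derivative frechet_derivative f (at x)) (at x)"
        using Suc.prems(1) that by (simp add: frechet_derivative_works)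
      then show ?thesis
        using has_derivative_transform_within_open[OF _ assms(1) that] Suc.prems(2) by blast
    qed
    have "Ck_on n S (\<lambda>x. frechet_derivative g (at x) v)" for v
    proof (rule Suc.IH)
      show "Ck_on n S (\<lambda>x. frechet_derivative f (at x) v)" using Suc.prems(1) by simp
      show "frechet_derivative f (at x) v = frechet_derivative g (at x) v" if "x \<in> S" for x
        using frechet_derivative_at[OF D[OF that]] by simp
    qed
    then show ?case using D by (auto simp: differentiable_def)
  qed
  show ?thesis using aux[of f g] aux[of g f] assms(2) by auto
qed

text \<open>Differentiability of class \<open>C\<^sup>n\<close> is a local property.\<close>

lemma Ck_on_local:
  assumes "\<And>x. x \<in> S \<Longrightarrow> \<exists>T. open T \<and> x \<in> T \<and> Ck_on n T f"
  shows "Ck_on n S f"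
  using assms
proof (induction n arbitrary: f)
  case 0
  show ?case
    unfolding Ck_on.simps
  proof (rule continuous_at_imp_continuous_on, rule ballI)
    fix x assume "x \<in> S"
    then obtain T where "open T" "x \<in> T" "continuous_on T f" using 0 by force
    then show "isCont f x" by (simp add: continuous_on_eq_continuous_at)
  qed
next
  case (Suc n)
  show ?case
    unfolding Ck_on.simps
  proof (intro conjI ballI allI)
    show "f differentiable at x" if "x \<in> S" for x
      using Suc.prems[OF that] by auto
    show "Ck_on n S (\<lambda>x. frechet_derivative f (at x) v)" for v
    proof (rule Suc.IH)
      fix x assume "x \<in> S"
      then show "\<exists>T. open T \<and> x \<in> T \<and> Ck_on n T (\<lambda>x. frechet_derivative f (at x) v)"
        using Suc.prems[of x] by auto
    qed
  qed
qed

text \<open>The induction step for a function whose derivative is known explicitly.\<close>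

lemma Ck_on_SucI:
  assumes "open S" "\<And>x. x \<in> S \<Longrightarrow> (f has_derivative f' x) (at x)"
    and "\<And>v. Ck_on n S (\<lambda>x. f' x v)"
  shows "Ck_on (Suc n) S f"
proof -
  have "frechet_derivative f (at x) v = f' x v" if "x \<in> S" for x v
    using frechet_derivative_at[OF assms(2)[OF that]] by simp
  then have "Ck_on n S (\<lambda>x. frechet_derivative f (at x) v)" for v
    using assms(3)[of v] Ck_on_cong[OF assms(1), of "\<lambda>x. frechet_derivative f (at x) v"] by fastforce
  then show ?thesis using assms(2) by (auto simp: differentiable_def)
qed

lemma Ck_on_derivative:
  assumes "Ck_on (Suc n) S f" "x \<in> S"
  shows "(f has_derivative frechet_derivative f (at x)) (at x)"
  using assms by (simp add: frechet_derivative_works)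

lemma Ck_on_const: "open S \<Longrightarrow> Ck_on n S (\<lambda>x. c)"
proof (induction n arbitrary: c)
  case (Suc n)
  show ?case by (rule Ck_on_SucI[where f' = "\<lambda>_ _. 0"]) (use Suc in auto)
qed auto

lemma Ck_on_bounded_linear:
  assumes "bounded_linear L" "open S"
  shows "Ck_on n S L"
proof (cases n)
  case 0
  then show ?thesis using assms(1) by (simp add: linear_continuous_on)
next
  case (Suc k)
  show ?thesis unfolding Suc
    by (rule Ck_on_SucI[where f' = "\<lambda>_. L"])
       (use assms in \<open>auto intro: Ck_on_const bounded_linear_imp_has_derivative\<close>)
qed

lemma Ck_on_add:
  assumes "open S" "Ck_on n S f" "Ck_on n S g"
  shows "Ck_on n S (\<lambda>x. f x + g x)"
  using assms(2,3)
proof (induction n arbitrary: f g)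
  case 0
  then show ?case by (auto intro: continuous_on_add)
next
  case (Suc n)
  show ?case
    by (rule Ck_on_SucI[OF assms(1) has_derivative_add[OF Ck_on_derivative[OF Suc.prems(1)]
        Ck_on_derivative[OF Suc.prems(2)]]]) (use Suc in auto)
qed

lemma Ck_on_sum:
  assumes "open S" "\<And>i. i \<in> I \<Longrightarrow> Ck_on n S (f i)"
  shows "Ck_on n S (\<lambda>x. \<Sum>i\<in>I. f i x)"
  using assms(2)
proof (induction I rule: infinite_finite_induct)
  case (insert i I)
  then show ?case using Ck_on_add[OF assms(1), of n "f i"] by simp
qed (auto intro: Ck_on_const[OF assms(1)])

lemma Ck_on_bilinear:
  assumes "bounded_bilinear P" "open S" "Ck_on n S f" "Ck_on n S g"
  shows "Ck_on n S (\<lambda>x. P (f x) (g x))"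
  using assms(3,4)
proof (induction n arbitrary: f g)
  case 0
  then show ?case by (auto intro: bounded_bilinear.continuous_on[OF assms(1)])
next
  case (Suc n)
  show ?case
  proof (rule Ck_on_SucI[OF assms(2) bounded_bilinear.FDERIV[OF assms(1) Ck_on_derivative[OF Suc.prems(1)]
        Ck_on_derivative[OF Suc.prems(2)]]])
    fix v
    show "Ck_on n S (\<lambda>x. P (f x) (frechet_derivative g (at x) v) + P (frechet_derivative f (at x) v) (g x))"
      by (rule Ck_on_add[OF assms(2)]; rule Suc.IH) (use Suc.prems Ck_on_SucD in auto)
  qed auto
qed

lemma Ck_on_compose:
  fixes f :: "'b::euclidean_space \<Rightarrow> 'c::real_normed_vector"
    and h :: "'a::real_normed_vector \<Rightarrow> 'b"
  assumes "open S" "open T" "h ` S \<subseteq> T" "Ck_on n T f" "Ck_on n S h"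
  shows "Ck_on n S (f \<circ> h)"
  using assms(4,5)
proof (induction n arbitrary: f)
  case 0
  then show ?case using assms(3)
    by (metis Ck_on.simps(1) continuous_on_compose continuous_on_subset)
next
  case (Suc n)
  let ?f' = "\<lambda>x. frechet_derivative f (at x)" and ?h' = "\<lambda>x. frechet_derivative h (at x)"
  have D: "(f \<circ> h has_derivative (\<lambda>v. \<Sum>b\<in>Basis. (?h' x v \<bullet> b) *\<^sub>R ?f' (h x) b)) (at x)"
    if "x \<in> S" for x
  proof -
    have f: "(f has_derivative ?f' (h x)) (at (h x))"
      using Ck_on_derivative[OF Suc.prems(1)] assms(3) that by blast
    have *: "?f' (h x) w = (\<Sum>b\<in>Basis. (w \<bullet> b) *\<^sub>R ?f' (h x) b)" for w
      using has_derivative_linear[OF f]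
      by (subst euclidean_representation[of w, symmetric]) (simp only: linear_sum linear_scale)
    then show ?thesis
      using diff_chain_at[OF Ck_on_derivative[OF Suc.prems(2) that] f]
      by (simp only: o_def *[symmetric])
  qed
  show ?case
  proof (rule Ck_on_SucI[OF assms(1) D])
    fix v
    show "Ck_on n S (\<lambda>x. \<Sum>b\<in>Basis. (?h' x v \<bullet> b) *\<^sub>R ?f' (h x) b)"
    proof (intro Ck_on_sum[OF assms(1)] Ck_on_bilinear[OF bounded_bilinear_scaleR assms(1)]
        Ck_on_bilinear[OF bounded_bilinear_inner assms(1)])
      fix b :: 'b
      show "Ck_on n S (\<lambda>x. ?h' x v)" using Suc.prems(2) by simp
      show "Ck_on n S (\<lambda>x. b)" by (rule Ck_on_const[OF assms(1)])
      show "Ck_on n S (\<lambda>x. ?f' (h x) b)"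
        using Suc.IH[of "\<lambda>x. ?f' x b"] Suc.prems Ck_on_SucD by (auto simp: o_def)
    qed
  qed auto
qed

lemma smooth_on_compose:
  fixes f :: "'b::euclidean_space \<Rightarrow> 'c::real_normed_vector"
  assumes "open S" "open T" "h ` S \<subseteq> T" "smooth_on T f" "smooth_on S h"
  shows "smooth_on S (f \<circ> h)"
  using assms Ck_on_compose unfolding smooth_on_def by blast

lemma smooth_on_bilinear:
  assumes "bounded_bilinear P" "open S" "smooth_on S f" "smooth_on S g"
  shows "smooth_on S (\<lambda>x. P (f x) (g x))"
  using assms Ck_on_bilinear unfolding smooth_on_def by blast

lemma smooth_on_const: "open S \<Longrightarrow> smooth_on S (\<lambda>x. c)"
  unfolding smooth_on_def by (simp add: Ck_on_const)

lemma smooth_on_add: "open S \<Longrightarrow> smooth_on S f \<Longrightarrow> smooth_on S g \<Longrightarrow> smooth_on S (\<lambda>x. f x + g x)"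
  unfolding smooth_on_def by (simp add: Ck_on_add)

lemma smooth_on_subset: "smooth_on S f \<Longrightarrow> T \<subseteq> S \<Longrightarrow> smooth_on T f"
  unfolding smooth_on_def using Ck_on_subset by blast

lemma smooth_on_cong:
  "open S \<Longrightarrow> (\<And>x. x \<in> S \<Longrightarrow> f x = g x) \<Longrightarrow> smooth_on S f \<longleftrightarrow> smooth_on S g"
  unfolding smooth_on_def using Ck_on_cong by blast

lemma smooth_on_local:
  assumes "\<And>x. x \<in> S \<Longrightarrow> \<exists>T. open T \<and> x \<in> T \<and> smooth_on T f"
  shows "smooth_on S f"
  unfolding smooth_on_def
proof
  fix n show "Ck_on n S f"
    by (rule Ck_on_local) (use assms in \<open>auto simp: smooth_on_def\<close>)
qed

lemma smooth_on_has_derivative: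
  assumes "smooth_on S f" "x \<in> S"
  shows "(f has_derivative frechet_derivative f (at x)) (at x)"
  using assms Ck_on_derivative unfolding smooth_on_def by blast

lemma smooth_on_frechet_derivative:
  assumes "smooth_on S f"
  shows "smooth_on S (\<lambda>x. frechet_derivative f (at x) v)"
  using assms unfolding smooth_on_def by (metis Ck_on.simps(2))

subsection \<open>Bump functions\<close>

text \<open>The functions \<open>exp (-1/t) / t^k\<close> for \<open>t > 0\<close>, extended by \<open>0\<close>. The derivative of one of them
  is a linear combination of two others, so that all are smooth.\<close>

definition flat :: "nat \<Rightarrow> real \<Rightarrow> real" where
  "flat k t = (if t > 0 then exp (- inverse t) * inverse t ^ k else 0)"

lemma flat_derivative:
  "(flat k has_real_derivative (flat (k + 2) t - real k * flat (k + 1) t)) (at t)"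
proof -
  consider "t > 0" | "t < 0" | "t = 0" by linarith
  then show ?thesis
  proof cases
    case 1
    have "((\<lambda>t. exp (- inverse t) * inverse t ^ k) has_real_derivative
        (flat (k + 2) t - real k * flat (k + 1) t)) (at t)"
    proof -
      let ?u = "inverse t"
      have u: "(inverse has_real_derivative (- ?u * ?u)) (at t)"
        using DERIV_inverse[of t UNIV] 1 by (simp add: power2_eq_square)
      have "((\<lambda>t. exp (- inverse t) * inverse t ^ k) has_real_derivative
          exp (- ?u) * (?u * ?u) * ?u ^ k + (real k * ?u ^ (k - 1) * (- ?u * ?u)) * exp (- ?u)) (at t)"
        using DERIV_mult[OF DERIV_chain2[OF DERIV_exp DERIV_minus[OF u]] DERIV_chain2[OF DERIV_pow u]]
        by simp
      also have "exp (- ?u) * (?u * ?u) * ?u ^ k + (real k * ?u ^ (k - 1) * (- ?u * ?u)) * exp (- ?u)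
          = flat (k + 2) t - real k * flat (k + 1) t"
        using 1 by (cases k) (simp_all add: flat_def algebra_simps)
      finally show ?thesis .
    qed
    then show ?thesis
      by (rule has_field_derivative_transform_within_open[where S = "{0<..}"])
         (use 1 in \<open>auto simp: flat_def\<close>)
  next
    case 2
    have "((\<lambda>t. 0) has_real_derivative 0) (at t)" by simp
    then have "(flat k has_real_derivative 0) (at t)"
      by (rule has_field_derivative_transform_within_open[where S = "{..<0}"])
         (use 2 in \<open>auto simp: flat_def\<close>)
    then show ?thesis using 2 by (simp add: flat_def)
  next
    case 3
    have "((\<lambda>t. inverse t ^ Suc k / exp (inverse t)) \<longlongrightarrow> (0::real)) (at_right 0)"
      by (rule filterlim_compose[OF tendsto_power_div_exp_0 filterlim_inverse_at_top_right])
    then have "((\<lambda>t. flat k t / t) \<longlongrightarrow> 0) (at_right 0)"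
      by (rule Lim_transform_eventually)
         (auto simp: eventually_at_right_field flat_def exp_minus field_simps intro!: exI[of _ 1])
    moreover have "((\<lambda>t. flat k t / t) \<longlongrightarrow> 0) (at_left 0)"
      by (rule Lim_transform_eventually[OF tendsto_const])
         (auto simp: eventually_at_left_field flat_def intro!: exI[of _ "-1"])
    ultimately have "((\<lambda>t. flat k t / t) \<longlongrightarrow> 0) (at 0)"
      by (simp add: filterlim_split_at)
    then show ?thesis using 3 by (simp add: has_field_derivative_iff flat_def)
  qed
qed

lemma smooth_on_flat: "smooth_on UNIV (flat k)"
proof -
  have "Ck_on n UNIV (flat k)" for n
  proof (induction n arbitrary: k)
    case 0
    then show ?case
      using DERIV_isCont[OF flat_derivative] by (simp add: continuous_at_imp_continuous_on)
  next
    case (Suc n)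
    have D: "(flat k has_derivative (\<lambda>v. (flat (k + 2) t + (- real k) * flat (k + 1) t) * v)) (at t)" for t
      using flat_derivative[of k t] by (simp add: has_field_derivative_def)
    show ?case
      by (rule Ck_on_SucI[OF open_UNIV D])
         (intro Ck_on_bilinear[OF bounded_bilinear_mult] Ck_on_add Suc.IH Ck_on_const open_UNIV)
  qed
  then show ?thesis by (simp add: smooth_on_def)
qed

lemma bump_function_exists:
  fixes a :: "'a::euclidean_space"
  assumes "e > 0"
  obtains \<psi> :: "'a \<Rightarrow> real" where "smooth_on UNIV \<psi>" "\<psi> a = 1" "\<And>u. u \<notin> ball a e \<Longrightarrow> \<psi> u = 0"
proof
  let ?h = "\<lambda>u. e\<^sup>2 + (- ((u - a) \<bullet> (u - a)))"
  let ?\<psi> = "\<lambda>u. inverse (flat 0 (e\<^sup>2)) * (flat 0 \<circ> ?h) u"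
  have "smooth_on UNIV (\<lambda>u. u - a)"
    using Ck_on_add[OF open_UNIV Ck_on_bounded_linear[OF bounded_linear_ident] Ck_on_const[of _ _ "- a"]]
    by (auto simp: smooth_on_def)
  then have "smooth_on UNIV (\<lambda>u. (- 1) * ((u - a) \<bullet> (u - a)))"
    by (intro smooth_on_bilinear[OF bounded_bilinear_mult] smooth_on_bilinear[OF bounded_bilinear_inner]
        smooth_on_const open_UNIV)
  then have "smooth_on UNIV ?h"
    using smooth_on_add[OF open_UNIV smooth_on_const] by force
  then have "smooth_on UNIV (flat 0 \<circ> ?h)"
    by (intro smooth_on_compose[OF open_UNIV open_UNIV _ smooth_on_flat]) auto
  then show "smooth_on UNIV ?\<psi>"
    by (intro smooth_on_bilinear[OF bounded_bilinear_mult] smooth_on_const open_UNIV)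
  show "?\<psi> a = 1" using assms by (simp add: flat_def)
  show "?\<psi> u = 0" if "u \<notin> ball a e" for u
  proof -
    have "e\<^sup>2 \<le> (norm (u - a))\<^sup>2"
      using that assms by (intro power_mono) (auto simp: dist_norm norm_minus_commute)
    then show ?thesis by (simp add: flat_def power2_norm_eq_inner)
  qed
qed

section \<open>Smooth functions and fields on manifolds\<close>

lemma chart_domain_open: "smooth_atlas A \<Longrightarrow> c \<in> A \<Longrightarrow> open (fst c)"
  by (simp add: smooth_atlas_def)

lemma chart_homeomorphism:
  "smooth_atlas A \<Longrightarrow> c \<in> A \<Longrightarrow> homeomorphism (fst c) (snd c ` fst c) (snd c) (chart_inv c)"
  by (simp add: smooth_atlas_def)

lemma chart_at_mem:
  assumes "smooth_atlas A"
  shows "chart_at A x \<in> A" "x \<in> fst (chart_at A x)"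
proof -
  have "x \<in> (\<Union>c\<in>A. fst c)" using assms by (simp add: smooth_atlas_def)
  then have "\<exists>c. c \<in> A \<and> x \<in> fst c" by blast
  then have "chart_at A x \<in> A \<and> x \<in> fst (chart_at A x)"
    unfolding chart_at_def by (rule someI_ex)
  then show "chart_at A x \<in> A" "x \<in> fst (chart_at A x)" by auto
qed

lemma chart_inv_left:
  "smooth_atlas A \<Longrightarrow> c \<in> A \<Longrightarrow> x \<in> fst c \<Longrightarrow> chart_inv c (snd c x) = x"
  using chart_homeomorphism homeomorphism_apply1 by blast

lemma chart_image_open:
  assumes "smooth_atlas A" "c \<in> A" "open U"
  shows "open (snd c ` (fst c \<inter> U))"
proof -
  have "openin (top_of_set (snd c ` fst c)) (snd c ` (fst c \<inter> U))"
    using homeomorphism_imp_open_map[OF chart_homeomorphism[OF assms(1,2)]] assms(3)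
    by (simp add: openin_open_Int)
  moreover have "open (snd c ` fst c)" using assms by (simp add: smooth_atlas_def)
  ultimately show ?thesis using openin_open_trans by blast
qed

lemma smooth_fun_on_subset: "smooth_fun_on A U f \<Longrightarrow> V \<subseteq> U \<Longrightarrow> smooth_fun_on A V f"
  unfolding smooth_fun_on_def by (meson Int_mono image_mono order_refl smooth_on_subset)

lemma smooth_fun_on_cong:
  assumes "smooth_atlas A" "open U" "\<And>x. x \<in> U \<Longrightarrow> f x = g x"
  shows "smooth_fun_on A U f \<longleftrightarrow> smooth_fun_on A U g"
proof -
  have "smooth_on (snd c ` (fst c \<inter> U)) (f \<circ> chart_inv c)
      \<longleftrightarrow> smooth_on (snd c ` (fst c \<inter> U)) (g \<circ> chart_inv c)" if "c \<in> A" for c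
    using chart_image_open[OF assms(1) that assms(2)] chart_inv_left[OF assms(1) that] assms(3)
    by (intro smooth_on_cong) auto
  then show ?thesis unfolding smooth_fun_on_def by blast
qed

lemma smooth_fun_on_local:
  assumes "smooth_atlas A" "\<And>x. x \<in> U \<Longrightarrow> \<exists>V. open V \<and> x \<in> V \<and> smooth_fun_on A V f"
  shows "smooth_fun_on A U f"
  unfolding smooth_fun_on_def
proof
  fix c assume c: "c \<in> A"
  show "smooth_on (snd c ` (fst c \<inter> U)) (f \<circ> chart_inv c)"
  proof (rule smooth_on_local)
    fix u assume "u \<in> snd c ` (fst c \<inter> U)"
    then obtain x where x: "x \<in> fst c" "x \<in> U" "u = snd c x" by auto
    then obtain V where V: "open V" "x \<in> V" "smooth_fun_on A V f" using assms(2) by blast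
    show "\<exists>T. open T \<and> u \<in> T \<and> smooth_on T (f \<circ> chart_inv c)"
      using V x c chart_image_open[OF assms(1) c V(1)]
      by (intro exI[of _ "snd c ` (fst c \<inter> V)"]) (auto simp: smooth_fun_on_def)
  qed
qed

lemma smooth_fun_on_bilinear:
  assumes "smooth_atlas A" "open U" "bounded_bilinear P" "smooth_fun_on A U f" "smooth_fun_on A U h"
  shows "smooth_fun_on A U (\<lambda>x. P (f x) (h x))"
  using assms(4,5) smooth_on_bilinear[OF assms(3) chart_image_open[OF assms(1) _ assms(2)]]
  unfolding smooth_fun_on_def o_def by blast

lemma smooth_fun_on_const: "smooth_atlas A \<Longrightarrow> open U \<Longrightarrow> smooth_fun_on A U (\<lambda>x. a)"
  unfolding smooth_fun_on_def o_def by (simp add: chart_image_open smooth_on_const)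

lemma smooth_fun_on_add:
  assumes "smooth_atlas A" "open U" "smooth_fun_on A U f" "smooth_fun_on A U h"
  shows "smooth_fun_on A U (\<lambda>x. f x + h x)"
  using assms(3,4) smooth_on_add[OF chart_image_open[OF assms(1) _ assms(2)]]
  unfolding smooth_fun_on_def o_def by blast

lemma smooth_fun_on_chart:
  assumes "smooth_atlas A" "c \<in> A"
  shows "smooth_fun_on A (fst c) (snd c)"
  using assms unfolding smooth_fun_on_def smooth_atlas_def by blast

lemma smooth_fun_on_compose:
  fixes f :: "'m::{t2_space,second_countable_topology} \<Rightarrow> 'b::euclidean_space"
  assumes "smooth_atlas A" "open U" "open T" "f ` U \<subseteq> T" "smooth_fun_on A U f" "smooth_on T h"
  shows "smooth_fun_on A U (\<lambda>x. h (f x))"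
  unfolding smooth_fun_on_def
proof
  fix c assume c: "c \<in> A"
  have "(f \<circ> chart_inv c) ` (snd c ` (fst c \<inter> U)) \<subseteq> T"
    using assms(4) chart_inv_left[OF assms(1) c] by auto
  moreover have "smooth_on (snd c ` (fst c \<inter> U)) (f \<circ> chart_inv c)"
    using assms(5) c by (simp add: smooth_fun_on_def)
  ultimately have "smooth_on (snd c ` (fst c \<inter> U)) (h \<circ> (f \<circ> chart_inv c))"
    using smooth_on_compose[OF chart_image_open[OF assms(1) c assms(2)] assms(3) _ assms(6)] by blast
  then show "smooth_on (snd c ` (fst c \<inter> U)) ((\<lambda>x. h (f x)) \<circ> chart_inv c)"
    by (simp add: o_def)
qed

lemma smooth_fun_on_chart_derivative:
  assumes "smooth_fun_on A U f" "c \<in> A" "x \<in> U" "x \<in> fst c"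
  shows "(f \<circ> chart_inv c has_derivative frechet_derivative (f \<circ> chart_inv c) (at (snd c x)))
    (at (snd c x))"
  using assms smooth_on_has_derivative unfolding smooth_fun_on_def by blast

lemma has_derivative_differential:
  assumes "smooth_atlas A" "smooth_fun_on A U f" "x \<in> U"
  shows "(f \<circ> chart_inv (chart_at A x) has_derivative differential A f x)
    (at (snd (chart_at A x) x))"
  using smooth_fun_on_chart_derivative[OF assms(2) chart_at_mem(1)[OF assms(1)] assms(3)
      chart_at_mem(2)[OF assms(1)]]
  unfolding differential_def[abs_def] by (simp add: eta_contract_eq)

lemma differential_eqI:
  assumes "(f \<circ> chart_inv (chart_at A x) has_derivative f') (at (snd (chart_at A x) x))"
  shows "differential A f x = f'"
  using frechet_derivative_at[OF assms] unfolding differential_def by auto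

text \<open>Derivatives with respect to the coordinates of a chart depend on germs only.\<close>

lemma chart_derivative_cong:
  assumes "smooth_atlas A" "c \<in> A" "x \<in> fst c" "open U" "x \<in> U" "\<And>y. y \<in> U \<Longrightarrow> f y = h y"
    and "(f \<circ> chart_inv c has_derivative f') (at (snd c x))"
  shows "(h \<circ> chart_inv c has_derivative f') (at (snd c x))"
proof (rule has_derivative_transform_within_open[OF assms(7) chart_image_open[OF assms(1,2,4)]])
  show "snd c x \<in> snd c ` (fst c \<inter> U)" using assms(3,5) by blast
qed (use chart_inv_left[OF assms(1,2)] assms(6) in auto)

subsection \<open>Coordinate fields\<close>

text \<open>The coordinate changes satisfy the chain rule. This is what relates \<open>differential\<close> and
  \<open>coordinate_field\<close>, which convert between components in the preferred chart and in another one.\<close>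

lemma coordinate_change_derivative:
  assumes "smooth_atlas A" "c \<in> A" "d \<in> A" "x \<in> fst c" "x \<in> fst d"
  shows "(snd d \<circ> chart_inv c has_derivative frechet_derivative (snd d \<circ> chart_inv c) (at (snd c x)))
    (at (snd c x))"
  using smooth_fun_on_chart_derivative[OF smooth_fun_on_chart[OF assms(1,3)] assms(2,5,4)] .

lemma coordinate_change_chain:
  assumes "smooth_atlas A" "c \<in> A" "d \<in> A" "e \<in> A" "x \<in> fst c" "x \<in> fst d" "x \<in> fst e"
  shows "frechet_derivative (snd e \<circ> chart_inv d) (at (snd d x))
      (frechet_derivative (snd d \<circ> chart_inv c) (at (snd c x)) v)
    = frechet_derivative (snd e \<circ> chart_inv c) (at (snd c x)) v"
proof -
  have eq: "(snd d \<circ> chart_inv c) (snd c x) = snd d x"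
    using chart_inv_left[OF assms(1,2,5)] by simp
  have "((snd e \<circ> chart_inv d \<circ> snd d) \<circ> chart_inv c has_derivative
      frechet_derivative (snd e \<circ> chart_inv d) (at (snd d x)) \<circ>
      frechet_derivative (snd d \<circ> chart_inv c) (at (snd c x))) (at (snd c x))"
    using diff_chain_at[OF coordinate_change_derivative[OF assms(1,2,3,5,6)],
        of "snd e \<circ> chart_inv d"] coordinate_change_derivative[OF assms(1,3,4,6,7)]
    unfolding eq by (simp add: o_assoc)
  then have "(snd e \<circ> chart_inv c has_derivative
      frechet_derivative (snd e \<circ> chart_inv d) (at (snd d x)) \<circ>
      frechet_derivative (snd d \<circ> chart_inv c) (at (snd c x))) (at (snd c x))"
    by (rule chart_derivative_cong[OF assms(1,2,5) chart_domain_open[OF assms(1,3)] assms(6), rotated])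
       (simp add: chart_inv_left[OF assms(1,3)])
  from frechet_derivative_at[OF this, symmetric] show ?thesis by simp
qed

lemma coordinate_change_same:
  assumes "smooth_atlas A" "c \<in> A" "x \<in> fst c"
  shows "frechet_derivative (snd c \<circ> chart_inv c) (at (snd c x)) v = v"
proof -
  have "(snd c \<circ> chart_inv c has_derivative (\<lambda>v. v)) (at (snd c x))"
  proof (rule has_derivative_transform_within_open[OF has_derivative_ident])
    show "open (snd c ` (fst c \<inter> UNIV))" using assms by (intro chart_image_open) auto
  qed (use assms chart_inv_left[OF assms(1,2)] in auto)
  from frechet_derivative_at[OF this, symmetric] show ?thesis by simp
qed

lemma differential_coordinate_field:
  assumes "smooth_atlas A" "c \<in> A" "d \<in> A" "x \<in> fst c" "x \<in> fst d"
  shows "differential A (snd d) x (coordinate_field A c b x)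
    = frechet_derivative (snd d \<circ> chart_inv c) (at (snd c x)) b"
  unfolding differential_def coordinate_field_def
  using coordinate_change_chain[OF assms(1,2) chart_at_mem(1)[OF assms(1)] assms(3,4)
      chart_at_mem(2)[OF assms(1)] assms(5)] .

lemma coordinate_field_differential:
  assumes "smooth_atlas A" "c \<in> A" "x \<in> fst c"
  shows "coordinate_field A c (differential A (snd c) x v) x = v"
  unfolding differential_def coordinate_field_def
  using coordinate_change_chain[OF assms(1) chart_at_mem(1)[OF assms(1)] assms(2)
      chart_at_mem(1)[OF assms(1)] chart_at_mem(2)[OF assms(1)] assms(3) chart_at_mem(2)[OF assms(1)]]
    coordinate_change_same[OF assms(1) chart_at_mem[OF assms(1)]]
  by simp

lemma differential_chart_linear:
  assumes "smooth_atlas A" "c \<in> A" "x \<in> fst c"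
  shows "linear (differential A (snd c) x)"
  using has_derivative_linear[OF has_derivative_differential[OF assms(1)
        smooth_fun_on_chart[OF assms(1,2)] assms(3)]] .

lemma coordinate_field_linear:
  assumes "smooth_atlas A" "c \<in> A" "x \<in> fst c"
  shows "linear (\<lambda>b. coordinate_field A c b x)"
  unfolding coordinate_field_def
  using has_derivative_linear[OF coordinate_change_derivative[OF assms(1,2) chart_at_mem(1)[OF assms(1)]
        assms(3) chart_at_mem(2)[OF assms(1)]]] by (simp add: eta_contract_eq)

text \<open>Every vector field is, on the domain of a chart, a combination of coordinate fields.\<close>

lemma coordinate_field_expansion:
  assumes "smooth_atlas A" "c \<in> A" "x \<in> fst c"
  shows "v = (\<Sum>b\<in>Basis. (differential A (snd c) x v \<bullet> b) *\<^sub>R coordinate_field A c b x)"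
proof -
  have "v = coordinate_field A c (\<Sum>b\<in>Basis. (differential A (snd c) x v \<bullet> b) *\<^sub>R b) x"
    using coordinate_field_differential[OF assms] by (simp add: euclidean_representation)
  also have "\<dots> = (\<Sum>b\<in>Basis. (differential A (snd c) x v \<bullet> b) *\<^sub>R coordinate_field A c b x)"
    by (simp only: linear_sum[OF coordinate_field_linear[OF assms]]
        linear_scale[OF coordinate_field_linear[OF assms]])
  finally show ?thesis .
qed

lemma coordinate_field_preferred:
  "smooth_atlas A \<Longrightarrow> coordinate_field A (chart_at A x) b x = b"
  unfolding coordinate_field_def by (simp add: coordinate_change_same chart_at_mem)

lemma differential_preferred:
  "smooth_atlas A \<Longrightarrow> differential A (snd (chart_at A x)) x v = v"
  unfolding differential_def by (simp add: coordinate_change_same chart_at_mem)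

lemma coordinate_field_smooth:
  assumes "smooth_atlas A" "c \<in> A"
  shows "smooth_field_on A (fst c) (coordinate_field A c b)"
  unfolding smooth_field_on_def smooth_along_def id_def vimage_ident
proof
  fix d assume d: "d \<in> A"
  let ?U = "fst c \<inter> fst d"
  have oU: "open ?U" using chart_domain_open[OF assms(1)] assms(2) d by blast
  have "smooth_on (snd c ` (fst c \<inter> fst d))
      (\<lambda>u. frechet_derivative (snd d \<circ> chart_inv c) (at u) b)"
    using assms d by (intro smooth_on_frechet_derivative) (simp add: smooth_atlas_def)
  then have "smooth_fun_on A ?U (\<lambda>x. frechet_derivative (snd d \<circ> chart_inv c) (at (snd c x)) b)"
    using smooth_fun_on_compose[OF assms(1) oU chart_image_open[OF assms chart_domain_open[OF assms(1) d]]
        order_refl smooth_fun_on_subset[OF smooth_fun_on_chart[OF assms] Int_lower1]] by blast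
  then show "smooth_fun_on A ?U (\<lambda>x. differential A (snd d) x (coordinate_field A c b x))"
    by (rule smooth_fun_on_cong[OF assms(1) oU, THEN iffD1, rotated])
       (simp add: differential_coordinate_field[OF assms d])
qed

subsection \<open>Fields along a map\<close>

lemma smooth_along_cong:
  assumes "smooth_atlas B" "smooth_atlas A" "continuous_on UNIV \<iota>" "open U"
    and "\<And>x. x \<in> U \<Longrightarrow> Y x = Z x" "smooth_along B A \<iota> U Y"
  shows "smooth_along B A \<iota> U Z"
  unfolding smooth_along_def
proof
  fix c assume c: "c \<in> A"
  have "open (U \<inter> \<iota> -` fst c)"
    using assms(4) open_vimage[OF chart_domain_open[OF assms(2) c] assms(3)] by blast
  from smooth_fun_on_cong[OF assms(1) this, THEN iffD1]
  show "smooth_fun_on B (U \<inter> \<iota> -` fst c) (\<lambda>x. differential A (snd c) (\<iota> x) (Z x))"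
    using assms(5,6) c unfolding smooth_along_def by (metis (mono_tags, lifting) IntD1)
qed

lemma smooth_along_local:
  assumes "smooth_atlas B" "\<And>x. x \<in> U \<Longrightarrow> \<exists>V. open V \<and> x \<in> V \<and> smooth_along B A \<iota> V X"
    and "smooth_atlas A" "continuous_on UNIV \<iota>"
  shows "smooth_along B A \<iota> U X"
  unfolding smooth_along_def
proof
  fix c assume c: "c \<in> A"
  have o: "open (\<iota> -` fst c)" using open_vimage[OF chart_domain_open[OF assms(3) c] assms(4)] .
  show "smooth_fun_on B (U \<inter> \<iota> -` fst c) (\<lambda>x. differential A (snd c) (\<iota> x) (X x))"
  proof (rule smooth_fun_on_local[OF assms(1)])
    fix x assume x: "x \<in> U \<inter> \<iota> -` fst c"
    then obtain V where "open V" "x \<in> V" "smooth_along B A \<iota> V X" using assms(2) by blast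
    then show "\<exists>V. open V \<and> x \<in> V \<and> smooth_fun_on B V (\<lambda>x. differential A (snd c) (\<iota> x) (X x))"
      using c x o by (intro exI[of _ "V \<inter> \<iota> -` fst c"]) (auto simp: smooth_along_def)
  qed
qed

context
  fixes B :: "('n::{t2_space,second_countable_topology}, 'k::euclidean_space) chart set"
    and A :: "('m::{t2_space,second_countable_topology}, 'e::euclidean_space) chart set"
    and \<iota> :: "'n \<Rightarrow> 'm"
  assumes atlas: "smooth_atlas B" "smooth_atlas A" and cont: "continuous_on UNIV \<iota>"
begin

lemma smooth_along_zero: "open U \<Longrightarrow> smooth_along B A \<iota> U (\<lambda>x. 0)"
  unfolding smooth_along_def
proof
  fix c assume U: "open U" and c: "c \<in> A"
  have o: "open (U \<inter> \<iota> -` fst c)"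
    using U open_vimage[OF chart_domain_open[OF atlas(2) c] cont] by blast
  show "smooth_fun_on B (U \<inter> \<iota> -` fst c) (\<lambda>x. differential A (snd c) (\<iota> x) 0)"
    using smooth_fun_on_cong[OF atlas(1) o, of "\<lambda>x. 0" "\<lambda>x. differential A (snd c) (\<iota> x) 0"]
      smooth_fun_on_const[OF atlas(1) o] linear_0[OF differential_chart_linear[OF atlas(2) c]]
    by (metis IntD2 vimageE)
qed

lemma smooth_along_add:
  assumes "open U" "smooth_along B A \<iota> U X" "smooth_along B A \<iota> U Y"
  shows "smooth_along B A \<iota> U (\<lambda>x. X x + Y x)"
  unfolding smooth_along_def
proof
  fix c assume c: "c \<in> A"
  let ?V = "U \<inter> \<iota> -` fst c" and ?D = "\<lambda>x. differential A (snd c) (\<iota> x)"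
  have o: "open ?V"
    using assms(1) open_vimage[OF chart_domain_open[OF atlas(2) c] cont] by blast
  have "smooth_fun_on B ?V (\<lambda>x. ?D x (X x) + ?D x (Y x))"
    using assms c by (intro smooth_fun_on_add[OF atlas(1) o]) (auto simp: smooth_along_def)
  moreover have "?D x (X x) + ?D x (Y x) = ?D x (X x + Y x)" if "x \<in> ?V" for x
    using that linear_add[OF differential_chart_linear[OF atlas(2) c]] by simp
  ultimately show "smooth_fun_on B ?V (\<lambda>x. ?D x (X x + Y x))"
    using smooth_fun_on_cong[OF atlas(1) o] by (metis (no_types, lifting))
qed

lemma smooth_along_scale:
  assumes "open U" "smooth_fun_on B U f" "smooth_along B A \<iota> U Y"
  shows "smooth_along B A \<iota> U (\<lambda>x. f x *\<^sub>R Y x)"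
  unfolding smooth_along_def
proof
  fix c assume c: "c \<in> A"
  let ?V = "U \<inter> \<iota> -` fst c" and ?D = "\<lambda>x. differential A (snd c) (\<iota> x)"
  have o: "open ?V"
    using assms(1) open_vimage[OF chart_domain_open[OF atlas(2) c] cont] by blast
  have "smooth_fun_on B ?V (\<lambda>x. f x *\<^sub>R ?D x (Y x))"
    using assms c smooth_fun_on_subset[OF assms(2)]
    by (intro smooth_fun_on_bilinear[OF atlas(1) o bounded_bilinear_scaleR]) (auto simp: smooth_along_def)
  moreover have "f x *\<^sub>R ?D x (Y x) = ?D x (f x *\<^sub>R Y x)" if "x \<in> ?V" for x
    using that linear_scale[OF differential_chart_linear[OF atlas(2) c]] by simp
  ultimately show "smooth_fun_on B ?V (\<lambda>x. ?D x (f x *\<^sub>R Y x))"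
    using smooth_fun_on_cong[OF atlas(1) o] by (metis (no_types, lifting))
qed

lemma smooth_along_sum:
  assumes "open U" "\<And>i. i \<in> I \<Longrightarrow> smooth_along B A \<iota> U (X i)"
  shows "smooth_along B A \<iota> U (\<lambda>x. \<Sum>i\<in>I. X i x)"
  using assms(2)
proof (induction I rule: infinite_finite_induct)
  case (insert i I)
  then show ?case using smooth_along_add[OF assms(1), of "X i"] by simp
qed (use smooth_along_zero[OF assms(1)] in auto)

end

lemma smooth_bump_exists:
  assumes "smooth_atlas B" "open U" "x \<in> U"
  obtains \<phi> K where "smooth_fun_on B UNIV \<phi>" "\<phi> x = (1::real)" "closed K" "K \<subseteq> U"
    "\<And>y. y \<notin> K \<Longrightarrow> \<phi> y = 0"
proof -
  let ?c = "chart_at B x"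
  note c = chart_at_mem[OF assms(1), of x]
  let ?W = "snd ?c ` (fst ?c \<inter> U)"
  have "open ?W" "snd ?c x \<in> ?W"
    using chart_image_open[OF assms(1) c(1) assms(2)] c(2) assms(3) by auto
  then obtain e where e: "e > 0" "cball (snd ?c x) e \<subseteq> ?W"
    using open_contains_cball by blast
  obtain \<psi> :: "_ \<Rightarrow> real" where \<psi>: "smooth_on UNIV \<psi>" "\<psi> (snd ?c x) = 1"
    "\<And>u. u \<notin> ball (snd ?c x) e \<Longrightarrow> \<psi> u = 0"
    using bump_function_exists[OF e(1)] by metis
  define \<phi> where "\<phi> y = (if y \<in> fst ?c then \<psi> (snd ?c y) else 0)" for y
  let ?K = "chart_inv ?c ` cball (snd ?c x) e"
  have cont: "continuous_on (snd ?c ` fst ?c) (chart_inv ?c)"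
    using chart_homeomorphism[OF assms(1) c(1)] by (simp add: homeomorphism_def)
  have "compact ?K"
    using e(2) by (intro compact_continuous_image continuous_on_subset[OF cont]) auto
  then have K: "closed ?K" by (rule compact_imp_closed)
  have KU: "?K \<subseteq> fst ?c \<inter> U"
  proof
    fix y assume "y \<in> ?K"
    then obtain z where "z \<in> fst ?c \<inter> U" "y = chart_inv ?c (snd ?c z)" using e(2) by blast
    then show "y \<in> fst ?c \<inter> U" using chart_inv_left[OF assms(1) c(1)] by simp
  qed
  have zero: "\<phi> y = 0" if "y \<notin> ?K" for y
  proof (cases "y \<in> fst ?c")
    case True
    then have "snd ?c y \<notin> cball (snd ?c x) e"
      using that chart_inv_left[OF assms(1) c(1) True] by (metis imageI)
    then show ?thesis using \<psi>(3) True by (auto simp: \<phi>_def)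
  qed (simp add: \<phi>_def)
  have "smooth_fun_on B (fst ?c) (\<lambda>y. \<psi> (snd ?c y))"
    using smooth_fun_on_compose[OF assms(1) chart_domain_open[OF assms(1) c(1)] open_UNIV subset_UNIV
        smooth_fun_on_chart[OF assms(1) c(1)] \<psi>(1)] .
  then have 1: "smooth_fun_on B (fst ?c) \<phi>"
    using smooth_fun_on_cong[OF assms(1) chart_domain_open[OF assms(1) c(1)],
        of "\<lambda>y. \<psi> (snd ?c y)" \<phi>] by (simp add: \<phi>_def)
  have "open (- ?K)" using K by (simp add: open_Compl)
  then have 2: "smooth_fun_on B (- ?K) \<phi>"
    using smooth_fun_on_cong[OF assms(1) \<open>open (- ?K)\<close>, of "\<lambda>y. 0" \<phi>] zero
      smooth_fun_on_const[OF assms(1) \<open>open (- ?K)\<close>, of "0::real"] by simp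
  have "smooth_fun_on B UNIV \<phi>"
  proof (rule smooth_fun_on_local[OF assms(1)])
    fix y
    have "y \<in> fst ?c \<or> y \<in> - ?K" using KU by blast
    then show "\<exists>V. open V \<and> y \<in> V \<and> smooth_fun_on B V \<phi>"
      using 1 2 chart_domain_open[OF assms(1) c(1)] \<open>open (- ?K)\<close> by metis
  qed
  then show thesis
    using K KU zero \<psi>(2) c(2) by (intro that[of \<phi> ?K]) (auto simp: \<phi>_def)
qed

text \<open>Every vector of a subbundle is the value of a global section.\<close>

lemma section_through_vector:
  assumes "smooth_atlas B" "smooth_atlas A" "continuous_on UNIV \<iota>" "subbundle B A \<iota> k E" "v \<in> E x"
  obtains Z where "Z \<in> sections B A \<iota> E" "Z x = v"
proof -
  obtain U s where x: "x \<in> U" and "local_frame B A \<iota> k E U s"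
    using assms(4) unfolding subbundle_def by blast
  then have U: "open U" and s: "\<And>i. i < k \<Longrightarrow> smooth_along B A \<iota> U (s i)"
    and span: "\<And>y. y \<in> U \<Longrightarrow> span ((\<lambda>i. s i y) ` {..<k}) = E y"
    and inj: "inj_on (\<lambda>i. s i x) {..<k}"
    unfolding local_frame_def by auto
  have "v \<in> span ((\<lambda>i. s i x) ` {..<k})" using span[OF x] assms(5) by simp
  then obtain a where "v = (\<Sum>w\<in>(\<lambda>i. s i x) ` {..<k}. a w *\<^sub>R w)"
    unfolding span_finite[OF finite_imageI[OF finite_lessThan]] by blast
  then have v: "v = (\<Sum>i<k. a (s i x) *\<^sub>R s i x)" by (simp add: sum.reindex[OF inj])
  obtain \<phi> K where \<phi>: "smooth_fun_on B UNIV \<phi>" "\<phi> x = (1::real)" "closed K" "K \<subseteq> U"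
    "\<And>y. y \<notin> K \<Longrightarrow> \<phi> y = 0"
    using smooth_bump_exists[OF assms(1) U x] by metis
  define Z where "Z y = \<phi> y *\<^sub>R (\<Sum>i<k. a (s i x) *\<^sub>R s i y)" for y
  have "smooth_along B A \<iota> U (\<lambda>y. \<Sum>i<k. a (s i x) *\<^sub>R s i y)"
    using s by (intro smooth_along_sum[OF assms(1-3) U] smooth_along_scale[OF assms(1-3) U]
        smooth_fun_on_const[OF assms(1) U]) auto
  then have 1: "smooth_along B A \<iota> U Z"
    unfolding Z_def using smooth_along_scale[OF assms(1-3) U smooth_fun_on_subset[OF \<phi>(1)]] by blast
  have oK: "open (- K)" using \<phi>(3) by blast
  have 2: "smooth_along B A \<iota> (- K) Z"
    by (rule smooth_along_cong[OF assms(1-3) oK _ smooth_along_zero[OF assms(1-3) oK]])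
       (simp add: Z_def \<phi>(5))
  have "smooth_along B A \<iota> UNIV Z"
  proof (rule smooth_along_local[OF assms(1) _ assms(2,3)])
    fix y
    have "y \<in> U \<or> y \<in> - K" using \<phi>(4) by blast
    then show "\<exists>V. open V \<and> y \<in> V \<and> smooth_along B A \<iota> V Z"
      using 1 2 U oK by metis
  qed
  moreover have "Z y \<in> E y" for y
  proof (cases "y \<in> U")
    case True
    then show ?thesis unfolding Z_def span[OF True, symmetric]
      by (intro span_scale span_sum span_base) auto
  next
    case False
    \<comment> \<open>\<open>E y\<close> is the span of a frame around \<open>y\<close>, hence contains \<open>0\<close>.\<close>
    obtain U' s' where "y \<in> U'" "local_frame B A \<iota> k E U' s'"
      using assms(4) unfolding subbundle_def by blast
    then have "E y = span ((\<lambda>i. s' i y) ` {..<k})" unfolding local_frame_def by blast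
    moreover have "y \<notin> K" using False \<phi>(4) by blast
    ultimately show ?thesis using \<phi>(5) by (simp add: Z_def span_zero)
  qed
  ultimately show thesis
    using v \<phi>(2) by (intro that[of Z]) (auto simp: sections_def Z_def)
qed

section \<open>Connections along an immersion\<close>

lemma linear_Basis_expansion:
  fixes L :: "'a::euclidean_space \<Rightarrow> 'b::real_vector"
  assumes "linear L"
  shows "L u = (\<Sum>b\<in>Basis. (u \<bullet> b) *\<^sub>R L b)"
  by (subst euclidean_representation[of u, symmetric])
     (simp only: linear_sum[OF assms] linear_scale[OF assms])

lemma bilinear_Basis_expansion:
  fixes F :: "'a::euclidean_space \<Rightarrow> 'a \<Rightarrow> real"
  assumes "bilinear F"
  shows "F u v = (\<Sum>a\<in>Basis. \<Sum>b\<in>Basis. (u \<bullet> a) * (v \<bullet> b) * F a b)"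
proof -
  have "F u v = (\<Sum>a\<in>Basis. (u \<bullet> a) * F a v)"
    using linear_Basis_expansion[of "\<lambda>u. F u v" u] assms by (simp add: bilinear_def)
  also have "\<dots> = (\<Sum>a\<in>Basis. (u \<bullet> a) * (\<Sum>b\<in>Basis. (v \<bullet> b) * F a b))"
    using linear_Basis_expansion[of "F _" v] assms by (simp add: bilinear_def)
  finally show ?thesis by (simp add: sum_distrib_left mult.assoc)
qed

lemma affine_connection_scale:
  assumes "affine_connection A nab" "open U" "x \<in> U" "smooth_fun_on A U f" "smooth_field_on A U Y"
  shows "nab x v (\<lambda>y. f y *\<^sub>R Y y) = differential A f x v *\<^sub>R Y x + f x *\<^sub>R nab x v Y"
  using assms unfolding affine_connection_def smooth_fun_near_def smooth_field_near_def by blast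

lemma affine_connection_sum:
  assumes "smooth_atlas A" "affine_connection A nab" "open U" "x \<in> U"
    and "finite I" "\<And>i. i \<in> I \<Longrightarrow> smooth_field_on A U (Y i)"
  shows "nab x v (\<lambda>y. \<Sum>i\<in>I. Y i y) = (\<Sum>i\<in>I. nab x v (Y i))"
  using assms(5,6)
proof (induction I)
  case empty
  have "smooth_field_on A U (\<lambda>y. 0)"
    using smooth_along_zero[OF assms(1,1) continuous_on_id assms(3)]
    by (simp add: smooth_field_on_def id_def)
  \<comment> \<open>Leibniz rule for the zero function times the zero field\<close>
  from affine_connection_scale[OF assms(2-4) smooth_fun_on_const[OF assms(1,3), of 0] this, of v]
  show ?case by simp
next
  case (insert i I)
  have "smooth_field_on A U (\<lambda>y. \<Sum>i\<in>I. Y i y)"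
    using insert.prems smooth_along_sum[OF assms(1,1) continuous_on_id assms(3), of I Y]
    by (simp add: smooth_field_on_def id_def)
  then have "nab x v (\<lambda>y. Y i y + (\<Sum>i\<in>I. Y i y)) = nab x v (Y i) + nab x v (\<lambda>y. \<Sum>i\<in>I. Y i y)"
    using assms(2-4) insert.prems[of i] unfolding affine_connection_def smooth_field_near_def by blast
  then show ?case using insert by simp
qed

text \<open>A connection is local. Since its axioms only require smoothness near \<open>x\<close>, the Leibniz rule may be
  applied to the indicator function of a neighbourhood of \<open>x\<close>.\<close>

lemma affine_connection_cong:
  assumes "smooth_atlas A" "affine_connection A nab" "open U" "x \<in> U"
    and "smooth_field_on A U Y" "\<And>y. y \<in> U \<Longrightarrow> Y y = Z y"
  shows "nab x v Y = nab x v Z"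
proof -
  define f where "f = (indicator U :: _ \<Rightarrow> real)"
  have "smooth_fun_on A U f"
    using smooth_fun_on_cong[OF assms(1,3), of "\<lambda>_. 1" f] smooth_fun_on_const[OF assms(1,3), of "1::real"]
    by (simp add: f_def)
  moreover have "differential A f x = (\<lambda>_. 0)"
  proof (rule differential_eqI, rule chart_derivative_cong[OF assms(1) chart_at_mem[OF assms(1)] assms(3,4)])
    show "1 = f y" if "y \<in> U" for y using that by (simp add: f_def)
    show "((\<lambda>_. 1) \<circ> chart_inv (chart_at A x) has_derivative (\<lambda>_. 0)) (at (snd (chart_at A x) x))"
      by (simp add: o_def)
  qed
  moreover have "smooth_field_on A U Z" 
    using smooth_along_cong[OF assms(1,1) continuous_on_id assms(3,6)] assms(5)
    by (simp add: smooth_field_on_def id_def)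
  ultimately have "nab x v (\<lambda>y. f y *\<^sub>R Y y) = nab x v Y" "nab x v (\<lambda>y. f y *\<^sub>R Z y) = nab x v Z"
    using affine_connection_scale[OF assms(2-4), of f Y v] affine_connection_scale[OF assms(2-4), of f Z v]
      assms(4,5) by (auto simp: f_def)
  moreover have "(\<lambda>y. f y *\<^sub>R Y y) = (\<lambda>y. f y *\<^sub>R Z y)"
    using assms(6) by (auto simp: f_def indicator_def fun_eq_iff)
  ultimately show ?thesis by simp
qed

text \<open>The covariant derivative of a vector field in terms of its components in the preferred chart.\<close>

lemma affine_connection_components:
  assumes "smooth_atlas A" "affine_connection A nab" "c = chart_at A x"
    and "smooth_field_on A (fst c) Y"
  shows "nab x v Y = differential A (\<lambda>z. differential A (snd c) z (Y z)) x v
    + (\<Sum>b\<in>Basis. (Y x \<bullet> b) *\<^sub>R nab x v (coordinate_field A c b))"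
proof -
  have c: "c \<in> A" "x \<in> fst c" using chart_at_mem[OF assms(1)] assms(3) by auto
  have oc: "open (fst c)" by (rule chart_domain_open[OF assms(1) c(1)])
  let ?F = "\<lambda>z. differential A (snd c) z (Y z)" and ?E = "coordinate_field A c"
  have F: "smooth_fun_on A (fst c) ?F"
    using assms(4) c(1) unfolding smooth_field_on_def smooth_along_def by force
  have Fb: "smooth_fun_on A (fst c) (\<lambda>z. ?F z \<bullet> b)" for b
    by (rule smooth_fun_on_bilinear[OF assms(1) oc bounded_bilinear_inner F smooth_fun_on_const[OF assms(1) oc]])
  have Fb': "differential A (\<lambda>z. ?F z \<bullet> b) x v = differential A ?F x v \<bullet> b" for b
  proof -
    have "((\<lambda>z. ?F z \<bullet> b) \<circ> chart_inv (chart_at A x) has_derivative (\<lambda>v. differential A ?F x v \<bullet> b))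
        (at (snd (chart_at A x) x))"
      using has_derivative_inner_left[OF has_derivative_differential[OF assms(1) F c(2)]]
      by (simp add: o_def)
    from differential_eqI[OF this] show ?thesis by simp
  qed
  have E: "smooth_field_on A (fst c) (?E b)" for b by (rule coordinate_field_smooth[OF assms(1) c(1)])
  have "nab x v Y = nab x v (\<lambda>z. \<Sum>b\<in>Basis. (?F z \<bullet> b) *\<^sub>R ?E b z)"
    by (rule affine_connection_cong[OF assms(1,2) oc c(2) assms(4)])
       (rule coordinate_field_expansion[OF assms(1) c(1)])
  also have "\<dots> = (\<Sum>b\<in>Basis. nab x v (\<lambda>z. (?F z \<bullet> b) *\<^sub>R ?E b z))"
    using smooth_along_scale[OF assms(1,1) continuous_on_id oc Fb] E
    by (intro affine_connection_sum[OF assms(1,2) oc c(2)]) (auto simp: smooth_field_on_def id_def)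
  also have "\<dots> = (\<Sum>b\<in>Basis. (differential A ?F x v \<bullet> b) *\<^sub>R b + (Y x \<bullet> b) *\<^sub>R nab x v (?E b))"
  proof -
    have "?F x = Y x" "?E b x = b" for b
      unfolding assms(3) by (rule differential_preferred[OF assms(1)] coordinate_field_preferred[OF assms(1)])+
    then show ?thesis by (simp only: affine_connection_scale[OF assms(2) oc c(2) Fb E] Fb')
  qed
  finally show ?thesis by (simp add: sum.distrib euclidean_representation)
qed

lemma smooth_map_continuous: "smooth_map B A \<iota> \<Longrightarrow> continuous_on UNIV \<iota>"
  by (simp add: smooth_map_def)

lemma smooth_fun_on_pullback:
  assumes "smooth_atlas B" "smooth_atlas A" "smooth_map B A \<iota>" "open U" "smooth_fun_on A U f"
  shows "smooth_fun_on B (\<iota> -` U) (\<lambda>y. f (\<iota> y))"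
proof (rule smooth_fun_on_local[OF assms(1)])
  fix x assume x: "x \<in> \<iota> -` U"
  define c where "c = chart_at A (\<iota> x)"
  have c: "c \<in> A" "\<iota> x \<in> fst c" using chart_at_mem[OF assms(2)] unfolding c_def by auto
  define V where "V = \<iota> -` (fst c \<inter> U)"
  have oV: "open V"
    using open_vimage[OF open_Int[OF chart_domain_open[OF assms(2) c(1)] assms(4)]
        smooth_map_continuous[OF assms(3)]] by (simp add: V_def)
  have "smooth_fun_on B V (snd c \<circ> \<iota>)"
    using assms(3) c(1) smooth_fun_on_subset[of B "\<iota> -` fst c" _ V] by (auto simp: smooth_map_def V_def)
  moreover have "smooth_on (snd c ` (fst c \<inter> U)) (f \<circ> chart_inv c)"
    using assms(5) c(1) by (simp add: smooth_fun_on_def)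
  moreover have "(snd c \<circ> \<iota>) ` V \<subseteq> snd c ` (fst c \<inter> U)" by (auto simp: V_def)
  ultimately have "smooth_fun_on B V (\<lambda>y. (f \<circ> chart_inv c) ((snd c \<circ> \<iota>) y))"
    using smooth_fun_on_compose[OF assms(1) oV chart_image_open[OF assms(2) c(1) assms(4)]] by blast
  then have "smooth_fun_on B V (\<lambda>y. f (\<iota> y))"
    by (rule smooth_fun_on_cong[OF assms(1) oV, THEN iffD1, rotated])
       (simp add: chart_inv_left[OF assms(2) c(1)] V_def)
  then show "\<exists>V. open V \<and> x \<in> V \<and> smooth_fun_on B V (\<lambda>y. f (\<iota> y))"
    using oV x c(2) by (intro exI[of _ V]) (simp add: V_def)
qed

lemma smooth_along_pullback:
  assumes "smooth_atlas B" "smooth_atlas A" "smooth_map B A \<iota>" "open U" "smooth_field_on A U Y"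
  shows "smooth_along B A \<iota> (\<iota> -` U) (\<lambda>y. Y (\<iota> y))"
  unfolding smooth_along_def
proof
  fix c assume c: "c \<in> A"
  have "smooth_fun_on A (U \<inter> fst c) (\<lambda>z. differential A (snd c) z (Y z))"
    using assms(5) c by (simp add: smooth_field_on_def smooth_along_def id_def)
  from smooth_fun_on_pullback[OF assms(1-3) open_Int[OF assms(4) chart_domain_open[OF assms(2) c]] this]
  show "smooth_fun_on B (\<iota> -` U \<inter> \<iota> -` fst c) (\<lambda>x. differential A (snd c) (\<iota> x) (Y (\<iota> x)))"
    by simp
qed

text \<open>A smooth \<open>(1,1)\<close>-tensor field maps smooth fields along a smooth map to such fields.\<close>

lemma smooth_along_tensor:
  assumes at: "smooth_atlas B" "smooth_atlas A" and "smooth_map B A \<iota>"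
    and lin: "\<And>z. linear (J z)"
    and J: "\<And>U X. open U \<Longrightarrow> smooth_field_on A U X \<Longrightarrow> smooth_field_on A U (\<lambda>z. J z (X z))"
    and V: "smooth_along B A \<iota> UNIV V"
  shows "smooth_along B A \<iota> UNIV (\<lambda>y. J (\<iota> y) (V y))"
proof (rule smooth_along_local[OF at(1) _ at(2) smooth_map_continuous[OF assms(3)]])
  fix x
  define c where "c = chart_at A (\<iota> x)"
  have c: "c \<in> A" "\<iota> x \<in> fst c" using chart_at_mem[OF at(2)] unfolding c_def by auto
  note oc = chart_domain_open[OF at(2) c(1)] and cont = smooth_map_continuous[OF assms(3)]
  have oi: "open (\<iota> -` fst c)" by (rule open_vimage[OF oc cont])
  let ?F = "\<lambda>y. differential A (snd c) (\<iota> y) (V y)" and ?E = "coordinate_field A c"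
  have F: "smooth_fun_on B (\<iota> -` fst c) (\<lambda>y. ?F y \<bullet> b)" for b
    by (rule smooth_fun_on_bilinear[OF at(1) oi bounded_bilinear_inner _ smooth_fun_on_const[OF at(1) oi]])
       (use V c(1) in \<open>simp add: smooth_along_def\<close>)
  have "smooth_along B A \<iota> (\<iota> -` fst c) (\<lambda>y. J (\<iota> y) (?E b (\<iota> y)))" for b
    using smooth_along_pullback[OF at assms(3) oc J[OF oc coordinate_field_smooth[OF at(2) c(1)]]] .
  then have "smooth_along B A \<iota> (\<iota> -` fst c) (\<lambda>y. \<Sum>b\<in>Basis. (?F y \<bullet> b) *\<^sub>R J (\<iota> y) (?E b (\<iota> y)))"
    by (intro smooth_along_sum[OF at cont oi] smooth_along_scale[OF at cont oi F])
  moreover have "(\<Sum>b\<in>Basis. (?F y \<bullet> b) *\<^sub>R J (\<iota> y) (?E b (\<iota> y))) = J (\<iota> y) (V y)"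
    if "y \<in> \<iota> -` fst c" for y
    using that coordinate_field_expansion[OF at(2) c(1), of "\<iota> y" "V y"]
    by (simp add: linear_sum[OF lin, symmetric] linear_scale[OF lin, symmetric])
  ultimately have "smooth_along B A \<iota> (\<iota> -` fst c) (\<lambda>y. J (\<iota> y) (V y))"
    using smooth_along_cong[OF at cont oi] by (metis (no_types, lifting))
  then show "\<exists>U. open U \<and> x \<in> U \<and> smooth_along B A \<iota> U (\<lambda>y. J (\<iota> y) (V y))"
    using oi c(2) by (intro exI[of _ "\<iota> -` fst c"]) simp
qed

lemma pushforward_has_derivative:
  assumes "smooth_atlas B" "smooth_atlas A" "smooth_map B A \<iota>"
  shows "(snd (chart_at A (\<iota> x)) \<circ> \<iota> \<circ> chart_inv (chart_at B x) has_derivative pushforward B A \<iota> x)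
    (at (snd (chart_at B x) x))"
proof -
  have "smooth_fun_on B (\<iota> -` fst (chart_at A (\<iota> x))) (snd (chart_at A (\<iota> x)) \<circ> \<iota>)"
    using assms(3) chart_at_mem(1)[OF assms(2)] by (simp add: smooth_map_def)
  from has_derivative_differential[OF assms(1) this] show ?thesis
    using chart_at_mem(2)[OF assms(2)] by (simp add: pushforward_def)
qed

lemma pullback_has_derivative:
  assumes "smooth_atlas B" "smooth_atlas A" "smooth_map B A \<iota>" "smooth_fun_on A U f" "\<iota> x \<in> U"
  shows "((\<lambda>y. f (\<iota> y)) \<circ> chart_inv (chart_at B x) has_derivative
    (\<lambda>w. differential A f (\<iota> x) (pushforward B A \<iota> x w))) (at (snd (chart_at B x) x))"
proof -
  let ?c = "chart_at A (\<iota> x)" and ?d = "chart_at B x"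
  note c = chart_at_mem[OF assms(2), of "\<iota> x"] and d = chart_at_mem[OF assms(1), of x]
  have eq: "(snd ?c \<circ> \<iota> \<circ> chart_inv ?d) (snd ?d x) = snd ?c (\<iota> x)"
    using chart_inv_left[OF assms(1) d] by simp
  have "((f \<circ> chart_inv ?c \<circ> snd ?c \<circ> \<iota>) \<circ> chart_inv ?d has_derivative
      differential A f (\<iota> x) \<circ> pushforward B A \<iota> x) (at (snd ?d x))"
    using diff_chain_at[OF pushforward_has_derivative[OF assms(1-3), of x], of "f \<circ> chart_inv ?c"]
      has_derivative_differential[OF assms(2,4,5)] unfolding eq by (simp add: o_assoc)
  from chart_derivative_cong[OF assms(1) d
      open_vimage[OF chart_domain_open[OF assms(2) c(1)] smooth_map_continuous[OF assms(3)]] _ _ this,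
      of "\<lambda>y. f (\<iota> y)"]
  show ?thesis using c chart_inv_left[OF assms(2) c(1)] by (simp add: o_def)
qed

lemma components_along_has_derivative:
  assumes "smooth_atlas B" "smooth_atlas A" "smooth_along B A \<iota> UNIV V"
    and F: "F = (\<lambda>y. differential A (snd (chart_at A (\<iota> x))) (\<iota> y) (V y))"
  shows "(F \<circ> chart_inv (chart_at B x) has_derivative differential B F x) (at (snd (chart_at B x) x))"
proof (rule has_derivative_differential[OF assms(1)])
  show "smooth_fun_on B (\<iota> -` fst (chart_at A (\<iota> x))) F"
    using assms(3) chart_at_mem(1)[OF assms(2)] unfolding smooth_along_def F by simp
qed (simp add: chart_at_mem(2)[OF assms(2)])

lemma connection_along_eq:
  assumes "smooth_atlas A"
    and "F = (\<lambda>y. differential A (snd (chart_at A (\<iota> x))) (\<iota> y) (V y))"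
  shows "connection_along B A \<iota> nab x w V = differential B F x w
    + (\<Sum>b\<in>Basis. (V x \<bullet> b) *\<^sub>R
        nab (\<iota> x) (pushforward B A \<iota> x w) (coordinate_field A (chart_at A (\<iota> x)) b))"
  unfolding connection_along_def Let_def assms(2) by (simp add: differential_preferred[OF assms(1)])

text \<open>A parallel tensor field \<open>J\<close> commutes with the derivative along an immersion, as both sides may be
  computed in terms of the fields \<open>J E\<^sub>b\<close>, where the \<open>E\<^sub>b\<close> are the coordinate fields.\<close>

lemma connection_along_parallel:
  assumes at: "smooth_atlas B" "smooth_atlas A" and "smooth_map B A \<iota>" "affine_connection A nab"
    and lin: "\<And>z. linear (J z)"
    and J: "\<And>U X. open U \<Longrightarrow> smooth_field_on A U X \<Longrightarrow> smooth_field_on A U (\<lambda>z. J z (X z))"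
    and par: "\<And>z v Y. smooth_field_near A z Y \<Longrightarrow> nab z v (\<lambda>y. J y (Y y)) = J z (nab z v Y)"
    and V: "smooth_along B A \<iota> UNIV V"
  shows "connection_along B A \<iota> nab x w (\<lambda>y. J (\<iota> y) (V y)) = J (\<iota> x) (connection_along B A \<iota> nab x w V)"
proof -
  define c where "c = chart_at A (\<iota> x)"
  define d where "d = chart_at B x"
  define F where "F = (\<lambda>y. differential A (snd c) (\<iota> y) (V y))"
  define H where "H b z = differential A (snd c) z (J z (coordinate_field A c b z))" for b z
  define v where "v = pushforward B A \<iota> x w"
  let ?E = "coordinate_field A c" and ?z = "\<iota> x"
  have c: "c \<in> A" "?z \<in> fst c" and d: "d \<in> B" "x \<in> fst d"
    using chart_at_mem at unfolding c_def d_def by auto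
  note oc = chart_domain_open[OF at(2) c(1)]
  have oi: "open (\<iota> -` fst c)" by (rule open_vimage[OF oc smooth_map_continuous[OF assms(3)]])
  note smE = coordinate_field_smooth[OF at(2) c(1)]
  have smJE: "smooth_field_on A (fst c) (\<lambda>z. J z (?E b z))" for b using J[OF oc smE] .
  have H: "smooth_fun_on A (fst c) (H b)" for b
    using smJE[of b] c(1) unfolding H_def smooth_field_on_def smooth_along_def by force
  have Fx: "F x = V x" unfolding F_def c_def by (rule differential_preferred[OF at(2)])
  have Hx: "H b ?z = J ?z b" for b
    unfolding H_def c_def by (simp add: differential_preferred[OF at(2)] coordinate_field_preferred[OF at(2)])
  define G where "G = (\<lambda>y. differential A (snd c) (\<iota> y) (J (\<iota> y) (V y)))"
  have G: "(\<Sum>b\<in>Basis. (F y \<bullet> b) *\<^sub>R H b (\<iota> y)) = G y" if "y \<in> \<iota> -` fst c" for y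
  proof -
    have lin: "linear (\<lambda>u. differential A (snd c) (\<iota> y) (J (\<iota> y) (?E u (\<iota> y))))"
      using that linear_compose[OF coordinate_field_linear[OF at(2) c(1)]
          linear_compose[OF lin differential_chart_linear[OF at(2) c(1)]], of "\<iota> y" "\<iota> y" "\<iota> y"]
      by (simp add: o_def)
    show ?thesis
      using linear_Basis_expansion[OF lin, of "F y"] coordinate_field_differential[OF at(2) c(1)] that
      by (simp add: G_def F_def H_def)
  qed
  have "((\<lambda>y. \<Sum>b\<in>Basis. (F y \<bullet> b) *\<^sub>R H b (\<iota> y)) \<circ> chart_inv d has_derivative
      (\<lambda>w. \<Sum>b\<in>Basis. (F x \<bullet> b) *\<^sub>R differential A (H b) ?z (pushforward B A \<iota> x w)
        + (differential B F x w \<bullet> b) *\<^sub>R H b ?z)) (at (snd d x))"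
  proof -
    have "((\<lambda>u. F (chart_inv d u) \<bullet> b) has_derivative (\<lambda>w. differential B F x w \<bullet> b)) (at (snd d x))" for b
      using has_derivative_inner_left[OF components_along_has_derivative[OF at V F_def[unfolded c_def]]]
      unfolding d_def by (simp add: o_def)
    moreover have "((\<lambda>u. H b (\<iota> (chart_inv d u))) has_derivative
        (\<lambda>w. differential A (H b) ?z (pushforward B A \<iota> x w))) (at (snd d x))" for b
      using pullback_has_derivative[OF at assms(3) H c(2), of b] unfolding d_def by (simp add: o_def)
    ultimately show ?thesis
      using has_derivative_sum[OF has_derivative_scaleR, of Basis "\<lambda>b u. F (chart_inv d u) \<bullet> b"
          "\<lambda>b w. differential B F x w \<bullet> b" "snd d x" UNIV "\<lambda>b u. H b (\<iota> (chart_inv d u))"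
          "\<lambda>b w. differential A (H b) ?z (pushforward B A \<iota> x w)"]
        chart_inv_left[OF at(1) d] by (simp add: o_def)
  qed
  from chart_derivative_cong[OF at(1) d oi _ G this]
  have dG: "differential B G x w = (\<Sum>b\<in>Basis. (V x \<bullet> b) *\<^sub>R differential A (H b) ?z v)
      + (\<Sum>b\<in>Basis. (differential B F x w \<bullet> b) *\<^sub>R J ?z b)"
    using c(2) differential_eqI[of G B x] unfolding d_def v_def by (simp add: Fx Hx sum.distrib)
  have JE: "J ?z (nab ?z v (?E b)) = differential A (H b) ?z v + (\<Sum>a\<in>Basis. (J ?z b \<bullet> a) *\<^sub>R nab ?z v (?E a))"
    for b
  proof -
    have "smooth_field_near A ?z (?E b)"
      using oc c(2) smE unfolding smooth_field_near_def by blast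
    then have "J ?z (nab ?z v (?E b)) = nab ?z v (\<lambda>z. J z (?E b z))" using par by simp
    also have "\<dots> = differential A (H b) ?z v + (\<Sum>a\<in>Basis. (J ?z b \<bullet> a) *\<^sub>R nab ?z v (?E a))"
      using affine_connection_components[OF at(2) assms(4) c_def smJE, of v b]
      unfolding H_def[abs_def] by (simp add: c_def coordinate_field_preferred[OF at(2)])
    finally show ?thesis .
  qed
  have linM: "linear (\<lambda>u. \<Sum>a\<in>Basis. (J ?z u \<bullet> a) *\<^sub>R nab ?z v (?E a))"
    by (intro linear_compose_sum ballI)
       (auto simp: linear_iff linear_add[OF lin] linear_scale[OF lin] algebra_simps)
  have "connection_along B A \<iota> nab x w (\<lambda>y. J (\<iota> y) (V y))
      = differential B G x w + (\<Sum>a\<in>Basis. (J ?z (V x) \<bullet> a) *\<^sub>R nab ?z v (?E a))"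
    using connection_along_eq[OF at(2) G_def[unfolded c_def], of B nab w] by (simp add: v_def c_def)
  also have "\<dots> = (\<Sum>b\<in>Basis. (differential B F x w \<bullet> b) *\<^sub>R J ?z b)
      + (\<Sum>b\<in>Basis. (V x \<bullet> b) *\<^sub>R J ?z (nab ?z v (?E b)))"
    by (simp add: dG JE linear_Basis_expansion[OF linM, of "V x"] scaleR_add_right sum.distrib)
  also have "\<dots> = J ?z (differential B F x w + (\<Sum>b\<in>Basis. (V x \<bullet> b) *\<^sub>R nab ?z v (?E b)))"
    using linear_Basis_expansion[OF lin, of ?z "differential B F x w"]
    by (simp add: linear_add[OF lin] linear_sum[OF lin] linear_scale[OF lin])
  also have "\<dots> = J ?z (connection_along B A \<iota> nab x w V)"
    using connection_along_eq[OF at(2) F_def[unfolded c_def], of B nab w] by (simp add: v_def c_def)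
  finally show ?thesis .
qed

text \<open>The derivative along an immersion is compatible with the metric; only the case of orthogonal
  fields is stated.\<close>

lemma connection_along_orthogonal:
  assumes at: "smooth_atlas B" "smooth_atlas A" and "smooth_map B A \<iota>"
    and g: "semi_riemannian A g" "levi_civita A g nab"
    and V: "smooth_along B A \<iota> UNIV V" and X: "smooth_along B A \<iota> UNIV X"
    and orth: "\<And>y. g (\<iota> y) (V y) (X y) = 0"
  shows "g (\<iota> x) (connection_along B A \<iota> nab x w V) (X x) + g (\<iota> x) (V x) (connection_along B A \<iota> nab x w X) = 0"
proof -
  define c where "c = chart_at A (\<iota> x)"
  define d where "d = chart_at B x"
  define F where "F = (\<lambda>y. differential A (snd c) (\<iota> y) (V y))"
  define G where "G = (\<lambda>y. differential A (snd c) (\<iota> y) (X y))"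
  define \<gamma> where "\<gamma> a b z = g z (coordinate_field A c a z) (coordinate_field A c b z)" for a b z
  define v where "v = pushforward B A \<iota> x w"
  let ?E = "coordinate_field A c" and ?z = "\<iota> x"
  let ?M = "\<lambda>u. \<Sum>b\<in>Basis. (u \<bullet> b) *\<^sub>R nab ?z v (?E b)"
  have c: "c \<in> A" "?z \<in> fst c" and d: "d \<in> B" "x \<in> fst d"
    using chart_at_mem at unfolding c_def d_def by auto
  note oc = chart_domain_open[OF at(2) c(1)]
  have oi: "open (\<iota> -` fst c)" by (rule open_vimage[OF oc smooth_map_continuous[OF assms(3)]])
  note smE = coordinate_field_smooth[OF at(2) c(1)]
  have bil: "bilinear (g z)" for z using g(1) by (simp add: semi_riemannian_def)
  have \<gamma>: "smooth_fun_on A (fst c) (\<gamma> a b)" for a b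
    using g(1) oc smE unfolding \<gamma>_def[abs_def] semi_riemannian_def by blast
  have Fx: "F x = V x" and Gx: "G x = X x"
    unfolding F_def G_def c_def by (simp_all add: differential_preferred[OF at(2)])
  have \<gamma>x: "\<gamma> a b ?z = g ?z a b" for a b
    unfolding \<gamma>_def c_def by (simp add: coordinate_field_preferred[OF at(2)])
  have zero: "(\<Sum>a\<in>Basis. \<Sum>b\<in>Basis. (F y \<bullet> a) * (G y \<bullet> b) * \<gamma> a b (\<iota> y)) = 0" if "y \<in> \<iota> -` fst c" for y
  proof -
    have "bilinear (\<lambda>u u'. g (\<iota> y) (?E u (\<iota> y)) (?E u' (\<iota> y)))"
      using that bil[of "\<iota> y"] coordinate_field_linear[OF at(2) c(1), of "\<iota> y"]
      unfolding bilinear_def by (auto intro: linear_compose[unfolded o_def])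
    from bilinear_Basis_expansion[OF this, of "F y" "G y"] show ?thesis
      using coordinate_field_differential[OF at(2) c(1)] that orth[of y]
      by (simp add: F_def G_def \<gamma>_def)
  qed
  let ?dF = "differential B F x" and ?dG = "differential B G x"
  have "((\<lambda>y. \<Sum>a\<in>Basis. \<Sum>b\<in>Basis. (F y \<bullet> a) * (G y \<bullet> b) * \<gamma> a b (\<iota> y)) \<circ> chart_inv d has_derivative
      (\<lambda>w. \<Sum>a\<in>Basis. \<Sum>b\<in>Basis.
        (F x \<bullet> a) * (G x \<bullet> b) * differential A (\<gamma> a b) ?z (pushforward B A \<iota> x w)
        + ((F x \<bullet> a) * (?dG w \<bullet> b) + (?dF w \<bullet> a) * (G x \<bullet> b)) * \<gamma> a b ?z)) (at (snd d x))"
  proof -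
    have 1: "((\<lambda>u. F (chart_inv d u) \<bullet> a) has_derivative (\<lambda>w. ?dF w \<bullet> a)) (at (snd d x))" for a
      using has_derivative_inner_left[OF components_along_has_derivative[OF at V F_def[unfolded c_def]]]
      unfolding d_def by (simp add: o_def)
    have 2: "((\<lambda>u. G (chart_inv d u) \<bullet> b) has_derivative (\<lambda>w. ?dG w \<bullet> b)) (at (snd d x))" for b
      using has_derivative_inner_left[OF components_along_has_derivative[OF at X G_def[unfolded c_def]]]
      unfolding d_def by (simp add: o_def)
    have 3: "((\<lambda>u. \<gamma> a b (\<iota> (chart_inv d u))) has_derivative
        (\<lambda>w. differential A (\<gamma> a b) ?z (pushforward B A \<iota> x w))) (at (snd d x))" for a b
      using pullback_has_derivative[OF at assms(3) \<gamma> c(2), of a b] unfolding d_def by (simp add: o_def)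
    have "((\<lambda>u. (F (chart_inv d u) \<bullet> a) * (G (chart_inv d u) \<bullet> b) * \<gamma> a b (\<iota> (chart_inv d u))) has_derivative
        (\<lambda>w. (F x \<bullet> a) * (G x \<bullet> b) * differential A (\<gamma> a b) ?z (pushforward B A \<iota> x w)
        + ((F x \<bullet> a) * (?dG w \<bullet> b) + (?dF w \<bullet> a) * (G x \<bullet> b)) * \<gamma> a b ?z)) (at (snd d x))" for a b
      using has_derivative_mult[OF has_derivative_mult[OF 1 2] 3] unfolding chart_inv_left[OF at(1) d] .
    then show ?thesis unfolding o_def by (intro has_derivative_sum)
  qed
  from chart_derivative_cong[OF at(1) d oi _ zero this]
  have "((\<lambda>y. 0) \<circ> chart_inv d has_derivative
      (\<lambda>w. \<Sum>a\<in>Basis. \<Sum>b\<in>Basis.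
        (F x \<bullet> a) * (G x \<bullet> b) * differential A (\<gamma> a b) ?z (pushforward B A \<iota> x w)
        + ((F x \<bullet> a) * (?dG w \<bullet> b) + (?dF w \<bullet> a) * (G x \<bullet> b)) * \<gamma> a b ?z)) (at (snd d x))"
    using c(2) by simp
  moreover have "((\<lambda>y. 0::real) \<circ> chart_inv d has_derivative (\<lambda>w. 0)) (at (snd d x))"
    by (simp add: o_def)
  ultimately have *: "0 = (\<Sum>a\<in>Basis. \<Sum>b\<in>Basis.
        (V x \<bullet> a) * (X x \<bullet> b) * differential A (\<gamma> a b) ?z v
        + ((V x \<bullet> a) * (?dG w \<bullet> b) + (?dF w \<bullet> a) * (X x \<bullet> b)) * g ?z a b)"
    unfolding v_def Fx Gx \<gamma>x by (blast dest: has_derivative_unique fun_cong)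
  have d\<gamma>: "differential A (\<gamma> a b) ?z v = g ?z (nab ?z v (?E a)) b + g ?z a (nab ?z v (?E b))" for a b
  proof -
    have "smooth_field_near A ?z (?E b)" for b
      using oc c(2) smE unfolding smooth_field_near_def by blast
    then have "differential A (\<gamma> a b) ?z v
        = g ?z (nab ?z v (?E a)) (?E b ?z) + g ?z (?E a ?z) (nab ?z v (?E b))"
      using g(2) unfolding levi_civita_def \<gamma>_def[abs_def] by blast
    then show ?thesis by (simp add: c_def coordinate_field_preferred[OF at(2)])
  qed
  \<comment> \<open>\<open>?M\<close> extends \<open>b \<mapsto> \<nabla>\<^sub>v E\<^sub>b\<close> linearly, which turns the sums with \<open>\<nabla>\<^sub>v E\<^sub>b\<close> into bilinear forms.\<close>
  have linM: "linear ?M"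
    by (intro linear_compose_sum ballI) (auto simp: linear_iff algebra_simps)
  have Mb: "?M b = nab ?z v (?E b)" if "b \<in> Basis" for b
    using that by (simp add: inner_Basis if_distrib if_distribR cong: if_cong)
  have b1: "bilinear (\<lambda>u u'. g ?z (?M u) u')" and b2: "bilinear (\<lambda>u u'. g ?z u (?M u'))"
    using bil[of ?z] linM unfolding bilinear_def by (auto intro: linear_compose[unfolded o_def])
  have "0 = (\<Sum>a\<in>Basis. \<Sum>b\<in>Basis. (V x \<bullet> a) * (X x \<bullet> b) * g ?z (?M a) b)
      + (\<Sum>a\<in>Basis. \<Sum>b\<in>Basis. (V x \<bullet> a) * (X x \<bullet> b) * g ?z a (?M b))
      + (\<Sum>a\<in>Basis. \<Sum>b\<in>Basis. (V x \<bullet> a) * (?dG w \<bullet> b) * g ?z a b)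
      + (\<Sum>a\<in>Basis. \<Sum>b\<in>Basis. (?dF w \<bullet> a) * (X x \<bullet> b) * g ?z a b)"
    unfolding * d\<gamma> sum.distrib[symmetric]
    by (intro sum.cong refl) (simp add: Mb algebra_simps)
  also have "\<dots> = g ?z (?M (V x)) (X x) + g ?z (V x) (?M (X x)) + g ?z (V x) (?dG w) + g ?z (?dF w) (X x)"
    unfolding bilinear_Basis_expansion[OF b1, of "V x" "X x"] bilinear_Basis_expansion[OF b2, of "V x" "X x"]
      bilinear_Basis_expansion[OF bil, of ?z "V x" "?dG w"] bilinear_Basis_expansion[OF bil, of ?z "?dF w" "X x"] ..
  also have "\<dots> = g ?z (?dF w + ?M (V x)) (X x) + g ?z (V x) (?dG w + ?M (X x))"
    by (simp add: bilinear_ladd[OF bil] bilinear_radd[OF bil])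
  finally show ?thesis
    using connection_along_eq[OF at(2) F_def[unfolded c_def], of B nab w]
      connection_along_eq[OF at(2) G_def[unfolded c_def], of B nab w] by (simp add: v_def c_def)
qed

section \<open>The pointwise splitting of the ambient tangent space\<close>

lemma nondegenerate_projection:
  fixes b :: "'e::euclidean_space \<Rightarrow> 'e \<Rightarrow> real"
  assumes "bilinear b" "subspace E" "nondegenerate_on b E"
  obtains s where "s \<in> E" "\<And>w. w \<in> E \<Longrightarrow> b (v - s) w = 0"
proof -
  obtain O' where O: "O' \<subseteq> E" "pairwise orthogonal O'" "independent O'" "span O' = E" "finite O'"
    using orthogonal_basis_subspace[OF assms(2)] independent_imp_finite by metis
  \<comment> \<open>\<open>T u\<close> encodes the restriction of \<open>b u\<close> to \<open>E\<close> as a vector of \<open>E\<close>.\<close>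
  define T where "T u = (\<Sum>e\<in>O'. b u e *\<^sub>R e)" for u
  have lin: "linear T"
    unfolding T_def using assms(1)
    by (intro linear_compose_sum ballI) (auto simp: linear_iff bilinear_ladd bilinear_lmul algebra_simps)
  have TE: "T u \<in> E" for u
    unfolding T_def using O(1) by (intro subspace_sum[OF assms(2)] subspace_scale[OF assms(2)]) auto
  have T0: "b u w = 0" if "T u = 0" "w \<in> E" for u w
  proof -
    have "b u e = 0" if "e \<in> O'" for e
      using independentD[OF O(3,5) order_refl \<open>T u = 0\<close>[unfolded T_def] that] .
    then have "O' \<subseteq> {w. b u w = 0}" by blast
    moreover have "subspace {w. b u w = 0}"
      using assms(1) by (auto simp: subspace_def bilinear_radd bilinear_rmul bilinear_rzero)
    ultimately show ?thesis using \<open>w \<in> E\<close> O(4) span_minimal by blast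
  qed
  have "inj_on T E"
  proof (rule inj_onI)
    fix u w assume uw: "u \<in> E" "w \<in> E" "T u = T w"
    then have "u - w \<in> E" "T (u - w) = 0"
      using subspace_diff[OF assms(2)] linear_diff[OF lin] by auto
    then show "u = w" using T0 assms(3) unfolding nondegenerate_on_def by fastforce
  qed
  moreover have "span E = E" using assms(2) by (simp add: span_eq_iff)
  ultimately have "dim (T ` E) = dim E" using dim_image_eq[OF lin] by metis
  then have "T ` E = E"
    using subspace_dim_equal[OF linear_subspace_image[OF lin assms(2)] assms(2)] TE by auto
  then obtain s where s: "s \<in> E" "T s = T v" using TE[of v] by (metis imageE)
  then have "T (v - s) = 0" using linear_diff[OF lin] by simp
  then show thesis using that[OF s(1)] T0 by blast
qed

lemma component_eq:
  assumes "subspace E" "subspace F" "E \<inter> F = {0}" "a \<in> E" "v - a \<in> F"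
  shows "component E F v = a"
  unfolding component_def
proof (rule the_equality)
  fix a' assume a': "a' \<in> E \<and> v - a' \<in> F"
  then have "a' - a \<in> E" "(v - a) - (v - a') \<in> F"
    using assms subspace_diff by blast+
  then have "a' - a \<in> E \<inter> F" by simp
  then show "a' = a" using assms(3) by auto
qed (use assms in simp)

text \<open>The splitting at one point of a lightlike submanifold: \<open>T\<close> is the tangent space with radical \<open>R\<close>,
  \<open>S\<close>, \<open>Q\<close> and \<open>L\<close> are the screen, the screen transversal and the lightlike transversal space, and \<open>\<xi>\<close>, \<open>N\<close>
  are dual bases of \<open>R\<close> and \<open>L\<close>.\<close>

locale lightlike_splitting =
  fixes b :: "'e::euclidean_space \<Rightarrow> 'e \<Rightarrow> real" and T R S Q L :: "'e set"
    and r :: nat and \<xi> N :: "nat \<Rightarrow> 'e"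
  assumes bil: "bilinear b" and sym: "b v w = b w v"
    and subspaces: "subspace S" "subspace Q"
    and tangent: "span (R \<union> S) = T" and radical: "R = T \<inter> {v. \<forall>w\<in>T. b v w = 0}"
    and normal: "span (R \<union> Q) = {v. \<forall>w\<in>T. b v w = 0}"
    and nondeg: "nondegenerate_on b S" "nondegenerate_on b Q"
    and RS: "R \<inter> S = {0}"
    and transversal: "v \<in> L \<Longrightarrow> w \<in> S \<union> Q \<Longrightarrow> b v w = 0"
    and span_\<xi>: "span (\<xi> ` {..<r}) = R" and span_N: "span (N ` {..<r}) = L"
    and dual: "i < r \<Longrightarrow> j < r \<Longrightarrow> b (\<xi> i) (N j) = (if i = j then 1 else 0)"
    and null: "i < r \<Longrightarrow> j < r \<Longrightarrow> b (N i) (N j) = 0"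
begin

lemmas b_simps = bilinear_ladd[OF bil] bilinear_radd[OF bil] bilinear_lsub[OF bil] bilinear_rsub[OF bil]
  bilinear_lmul[OF bil] bilinear_rmul[OF bil] bilinear_lzero[OF bil] bilinear_rzero[OF bil]
  bilinear_lneg[OF bil] bilinear_rneg[OF bil]

lemma subspace_R: "subspace R" and subspace_L: "subspace L" and subspace_T: "subspace T"
  using span_\<xi> span_N tangent subspace_span by metis+

lemma R_sub_T: "v \<in> R \<Longrightarrow> v \<in> T" and S_sub_T: "v \<in> S \<Longrightarrow> v \<in> T"
  using tangent span_superset by fastforce+

lemma R_orth: "v \<in> R \<Longrightarrow> w \<in> T \<Longrightarrow> b v w = 0"
  using radical by blast

lemma Q_orth: "v \<in> Q \<Longrightarrow> w \<in> T \<Longrightarrow> b v w = 0"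
  using normal span_superset[of "R \<union> Q"] by blast

lemma orth_span: "(\<And>w. w \<in> E \<Longrightarrow> b v w = 0) \<Longrightarrow> w \<in> span E \<Longrightarrow> b v w = 0"
  using span_minimal[of E "{w. b v w = 0}"] by (auto simp: subspace_def b_simps)

lemma L_isotropic: "v \<in> L \<Longrightarrow> w \<in> L \<Longrightarrow> b v w = 0"
proof -
  assume v: "v \<in> L" and w: "w \<in> L"
  have "b (N j) v = 0" if "j < r" for j
    using orth_span[of "N ` {..<r}" "N j" v] null that v span_N by auto
  then have "b v (N j) = 0" if "j < r" for j using that sym by metis
  then show "b v w = 0"
    using orth_span[of "N ` {..<r}" v w] w span_N by auto
qed

lemma tangent_decomp:
  assumes "t \<in> T" obtains \<rho> s where "\<rho> \<in> R" "s \<in> S" "t = \<rho> + s"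
proof -
  have "t \<in> span (R \<union> S)" using assms tangent by simp
  then show thesis
    using that subspace_R subspaces(1) unfolding span_Un by (auto simp: span_eq_iff[THEN iffD2])
qed

lemma R_eq_0I:
  assumes "v \<in> R" "\<And>j. j < r \<Longrightarrow> b v (N j) = 0"
  shows "v = 0"
proof -
  have lin: "linear (\<lambda>v. \<Sum>i<r. b v (N i) *\<^sub>R \<xi> i)"
    by (intro linear_compose_sum ballI) (auto simp: linear_iff b_simps scaleR_add_left)
  have "subspace {v. v = (\<Sum>i<r. b v (N i) *\<^sub>R \<xi> i)}"
    using linear_0[OF lin] linear_add[OF lin] linear_scale[OF lin] by (simp add: subspace_def)
  moreover have "\<xi> k = (\<Sum>i<r. b (\<xi> k) (N i) *\<^sub>R \<xi> i)" if "k < r" for k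
  proof -
    have "(\<Sum>i<r. b (\<xi> k) (N i) *\<^sub>R \<xi> i) = (\<Sum>i<r. if k = i then \<xi> i else 0)"
      using dual that by (intro sum.cong) auto
    then show ?thesis using that by simp
  qed
  ultimately have "R \<subseteq> {v. v = (\<Sum>i<r. b v (N i) *\<^sub>R \<xi> i)}"
    unfolding span_\<xi>[symmetric] by (intro span_minimal) auto
  then have "v = (\<Sum>i<r. b v (N i) *\<^sub>R \<xi> i)" using assms(1) by blast
  then show ?thesis using assms(2) by simp
qed

lemma S_eq_0I: "s \<in> S \<Longrightarrow> (\<And>z. z \<in> S \<Longrightarrow> b s z = 0) \<Longrightarrow> s = 0"
  using nondeg(1) unfolding nondegenerate_on_def by blast

lemma Q_eq_0I: "n \<in> Q \<Longrightarrow> (\<And>z. z \<in> Q \<Longrightarrow> b n z = 0) \<Longrightarrow> n = 0"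
  using nondeg(2) unfolding nondegenerate_on_def by blast

lemma mem_R_iff:
  assumes "t \<in> T"
  shows "t \<in> R \<longleftrightarrow> (\<forall>z\<in>S. b t z = 0)"
proof
  assume t: "\<forall>z\<in>S. b t z = 0"
  obtain \<rho> s where *: "\<rho> \<in> R" "s \<in> S" "t = \<rho> + s" using tangent_decomp[OF assms] .
  have "b s z = 0" if "z \<in> S" for z
    using t that R_orth[OF *(1), of z] S_sub_T unfolding *(3) by (auto simp: b_simps)
  then show "t \<in> R" using S_eq_0I[OF *(2)] * by simp
qed (use R_orth S_sub_T in blast)

text \<open>The splitting spans the whole space: subtract from \<open>v\<close> its orthogonal projections to \<open>S\<close> and \<open>Q\<close> and its
  components in \<open>R\<close> and \<open>L\<close>, given by the dual bases. The rest \<open>u\<close> is orthogonal to \<open>S\<close>, \<open>Q\<close>, \<open>R\<close> and \<open>L\<close>.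
  Hence it is normal, even radical since \<open>Q\<close> is non-degenerate, and zero by duality.\<close>

lemma splitting_exists:
  obtains t l n where "t \<in> T" "l \<in> L" "n \<in> Q" "v = t + l + n"
proof -
  obtain s where s: "s \<in> S" "\<And>z. z \<in> S \<Longrightarrow> b (v - s) z = 0"
    using nondegenerate_projection[OF bil subspaces(1) nondeg(1)] by blast
  obtain n where n: "n \<in> Q" "\<And>z. z \<in> Q \<Longrightarrow> b (v - n) z = 0"
    using nondegenerate_projection[OF bil subspaces(2) nondeg(2)] by blast
  define \<rho> where "\<rho> = (\<Sum>i<r. b v (N i) *\<^sub>R \<xi> i)"
  define l where "l = (\<Sum>i<r. b v (\<xi> i) *\<^sub>R N i)"
  have \<xi>R: "\<xi> i \<in> R" if "i < r" for i
    using that span_\<xi> span_base[of "\<xi> i" "\<xi> ` {..<r}"] by simp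
  have NL: "N i \<in> L" if "i < r" for i
    using that span_N span_base[of "N i" "N ` {..<r}"] by simp
  have \<rho>: "\<rho> \<in> R" unfolding \<rho>_def using \<xi>R
    by (intro subspace_sum[OF subspace_R] subspace_scale[OF subspace_R]) auto
  have l: "l \<in> L" unfolding l_def using NL
    by (intro subspace_sum[OF subspace_L] subspace_scale[OF subspace_L]) auto
  have suml: "b (\<Sum>i<r. f i *\<^sub>R h i) w = (\<Sum>i<r. f i * b (h i) w)" for f h w
  proof -
    have "linear (\<lambda>x. b x w)" using bil by (simp add: bilinear_def)
    from linear_sum[OF this, of "\<lambda>i. f i *\<^sub>R h i"] show ?thesis by (simp add: b_simps)
  qed
  have \<rho>N: "b \<rho> (N j) = b v (N j)" if "j < r" for j
  proof -
    have "b \<rho> (N j) = (\<Sum>i<r. if i = j then b v (N i) else 0)"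
      unfolding \<rho>_def suml using that dual by (intro sum.cong) auto
    then show ?thesis using that by simp
  qed
  have l\<xi>: "b l (\<xi> j) = b v (\<xi> j)" if "j < r" for j
  proof -
    have "b l (\<xi> j) = (\<Sum>i<r. if i = j then b v (\<xi> i) else 0)"
      unfolding l_def suml using that dual sym by (intro sum.cong) auto
    then show ?thesis using that by simp
  qed
  define u where "u = v - s - n - \<rho> - l"
  have uS: "b u z = 0" if "z \<in> S" for z
    using s(2)[OF that] Q_orth[OF n(1), of z] R_orth[OF \<rho>, of z] transversal[OF l, of z] that S_sub_T
    unfolding u_def by (auto simp: b_simps)
  have uQ: "b u z = 0" if "z \<in> Q" for z
    using n(2)[OF that] Q_orth[OF that, of s] Q_orth[OF that, of \<rho>] transversal[OF l, of z] that s(1) \<rho>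
      S_sub_T R_sub_T sym[of s z] sym[of \<rho> z]
    unfolding u_def by (auto simp: b_simps)
  have u\<xi>: "b u (\<xi> j) = 0" if "j < r" for j
    using l\<xi>[OF that] R_orth[OF \<xi>R[OF that], of s] R_orth[OF \<xi>R[OF that], of \<rho>] Q_orth[OF n(1), of "\<xi> j"]
      \<xi>R[OF that] s(1) \<rho> S_sub_T R_sub_T sym[of s "\<xi> j"] sym[of \<rho> "\<xi> j"]
    unfolding u_def by (auto simp: b_simps)
  have uN: "b u (N j) = 0" if "j < r" for j
    using \<rho>N[OF that] transversal[OF NL[OF that], of s] transversal[OF NL[OF that], of n]
      L_isotropic[OF l NL[OF that]] s(1) n(1) sym[of s "N j"] sym[of n "N j"]
    unfolding u_def by (auto simp: b_simps)
  have "b u z = 0" if "z \<in> T" for z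
  proof (rule orth_span[of "\<xi> ` {..<r} \<union> S"])
    have "R \<union> S \<subseteq> span (\<xi> ` {..<r} \<union> S)"
      using span_\<xi> span_mono[of "\<xi> ` {..<r}" "\<xi> ` {..<r} \<union> S"] span_superset[of "\<xi> ` {..<r} \<union> S"] by auto
    then have "span (R \<union> S) \<subseteq> span (\<xi> ` {..<r} \<union> S)" by (intro span_minimal) auto
    then show "z \<in> span (\<xi> ` {..<r} \<union> S)" using that tangent by blast
  qed (use u\<xi> uS in auto)
  then have "u \<in> span (R \<union> Q)" using normal by blast
  then obtain \<rho>' n' where u: "\<rho>' \<in> R" "n' \<in> Q" "u = \<rho>' + n'"
    using subspace_R subspaces(2) unfolding span_Un by (auto simp: span_eq_iff[THEN iffD2])
  have "b n' z = 0" if "z \<in> Q" for z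
    using uQ[OF that] Q_orth[OF that, of \<rho>'] u(1) R_sub_T sym[of \<rho>' z] unfolding u(3) by (auto simp: b_simps)
  then have "n' = 0" using Q_eq_0I[OF u(2)] by blast
  then have "u = 0" using R_eq_0I[of u] u uN by simp
  then have "v = (\<rho> + s) + l + n" unfolding u_def by (simp add: algebra_simps)
  moreover have "\<rho> + s \<in> T" using \<rho> s(1) R_sub_T S_sub_T subspace_add[OF subspace_T] by blast
  ultimately show thesis using that l n(1) by blast
qed

lemma transversal_decomp:
  assumes "v \<in> span (L \<union> Q)" obtains l n where "l \<in> L" "n \<in> Q" "v = l + n"
  using assms that subspace_L subspaces(2) unfolding span_Un by (auto simp: span_eq_iff[THEN iffD2])

lemma tangent_component:
  defines "C \<equiv> component T (span (L \<union> Q))"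
  shows "C v \<in> T" "z \<in> S \<Longrightarrow> b (C v) z = b v z"
proof -
  have int: "T \<inter> span (L \<union> Q) = {0}"
  proof -
    have "t = 0" if t: "t \<in> T" "t \<in> span (L \<union> Q)" for t
    proof -
      obtain l n where ln: "l \<in> L" "n \<in> Q" "t = l + n" using transversal_decomp[OF t(2)] .
      have "b t z = 0" if "z \<in> S" for z
        using transversal[OF ln(1), of z] Q_orth[OF ln(2), of z] that S_sub_T unfolding ln(3)
        by (auto simp: b_simps)
      then have tR: "t \<in> R" using mem_R_iff[OF t(1)] by blast
      have "b t (N j) = 0" if "j < r" for j
      proof -
        have "N j \<in> L" using that span_N span_base[of "N j" "N ` {..<r}"] by simp
        then show ?thesis
          using L_isotropic[OF ln(1)] transversal[of "N j" n] ln(2) sym[of n "N j"] unfolding ln(3)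
          by (auto simp: b_simps)
      qed
      then show ?thesis by (rule R_eq_0I[OF tR])
    qed
    then show ?thesis using subspace_0[OF subspace_T] span_zero by blast
  qed
  obtain t l n where d: "t \<in> T" "l \<in> L" "n \<in> Q" "v = t + l + n" using splitting_exists .
  have "l + n \<in> span (L \<union> Q)" using d by (intro span_add) (auto intro: span_base)
  then have C: "C v = t"
    unfolding C_def using d by (intro component_eq[OF subspace_T subspace_span int]) (auto simp: algebra_simps)
  show "C v \<in> T" using C d(1) by simp
  show "b (C v) z = b v z" if "z \<in> S"
    using transversal[OF d(2), of z] Q_orth[OF d(3), of z] that S_sub_T
    unfolding C unfolding d(4) by (auto simp: b_simps)
qed

lemma screen_transversal_component:
  assumes "z \<in> Q"
  shows "b (component Q (span (T \<union> L)) v) z = b v z"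
proof -
  have orth: "b z w = 0" if "z \<in> Q" "w \<in> span (T \<union> L)" for z w
  proof (rule orth_span[OF _ that(2)])
    fix w' assume "w' \<in> T \<union> L"
    then show "b z w' = 0"
      using Q_orth[OF that(1), of w'] transversal[of w' z] that(1) sym[of z w'] by auto
  qed
  have "n = 0" if "n \<in> Q" "n \<in> span (T \<union> L)" for n
    using Q_eq_0I[OF that(1)] orth[OF _ that(2)] sym by metis
  then have int: "Q \<inter> span (T \<union> L) = {0}"
    using subspace_0[OF subspaces(2)] span_zero by blast
  obtain t l n where d: "t \<in> T" "l \<in> L" "n \<in> Q" "v = t + l + n" using splitting_exists .
  have tl: "t + l \<in> span (T \<union> L)" using d by (intro span_add) (auto intro: span_base)
  then have "component Q (span (T \<union> L)) v = n"
    using d by (intro component_eq[OF subspaces(2) subspace_span int]) (auto simp: algebra_simps)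
  then show ?thesis using orth[OF assms tl] sym[of z] unfolding d(4) by (simp add: b_simps)
qed

lemma screen_component:
  assumes "t \<in> T"
  shows "component S R t \<in> S" "z \<in> S \<Longrightarrow> b (component S R t) z = b t z"
proof -
  obtain \<rho> s where d: "\<rho> \<in> R" "s \<in> S" "t = \<rho> + s" using tangent_decomp[OF assms] .
  have "component S R t = s"
    using RS d by (intro component_eq[OF subspaces(1) subspace_R]) auto
  then show "component S R t \<in> S" "z \<in> S \<Longrightarrow> b (component S R t) z = b t z"
    using d R_orth[of \<rho> z] S_sub_T by (auto simp: b_simps)
qed

lemma screen_component_eq_0_iff: "t \<in> T \<Longrightarrow> component S R t = 0 \<longleftrightarrow> t \<in> R"
  using screen_component[of t] mem_R_iff[of t] S_eq_0I[of "component S R t"] by (auto simp: b_simps)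

end

lemma lightlike_submanifold_splitting:
  fixes A :: "('m::{t2_space,second_countable_topology}, 'e::euclidean_space) chart set"
    and B :: "('n::{t2_space,second_countable_topology}, 'k::euclidean_space) chart set"
  assumes "semi_riemannian A g" "lightlike_submanifold B A \<iota> g r S Str Ltr"
  shows "\<exists>\<xi> N. lightlike_splitting (g (\<iota> x)) (tangent_space B A \<iota> x) (radical_space B A \<iota> g x)
    (S x) (Str x) (Ltr x) r \<xi> N"
proof -
  let ?R = "radical_space B A \<iota> g" and ?T = "tangent_space B A \<iota>"
  note L = assms(2)[unfolded lightlike_submanifold_def]
  have bundles: "subbundle B A \<iota> r ?R" "subbundle B A \<iota> (DIM('k) - r) S"
    "subbundle B A \<iota> (DIM('e) - DIM('k) - r) Str"
    and S: "\<forall>x. nondegenerate_on (g (\<iota> x)) (S x) \<and> ?R x \<inter> S x = {0} \<and> span (?R x \<union> S x) = ?T x"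
    and Str: "\<forall>x. nondegenerate_on (g (\<iota> x)) (Str x) \<and> ?R x \<inter> Str x = {0} \<and>
        span (?R x \<union> Str x) = normal_space B A \<iota> g x"
    and Ltr: "\<forall>x. \<forall>v\<in>Ltr x. \<forall>w\<in>S x \<union> Str x. g (\<iota> x) v w = 0"
    and frames: "\<forall>U \<xi>. local_frame B A \<iota> r ?R U \<xi> \<longrightarrow> (\<exists>N. local_frame B A \<iota> r Ltr U N \<and>
      (\<forall>x\<in>U. \<forall>i<r. \<forall>j<r. g (\<iota> x) (\<xi> i x) (N j x) = (if i = j then 1 else 0) \<and>
        g (\<iota> x) (N i x) (N j x) = 0))"
    using L by - (elim conjE, assumption)+
  obtain U \<xi> where U: "x \<in> U" and \<xi>: "local_frame B A \<iota> r ?R U \<xi>"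
    using bundles(1) unfolding subbundle_def by blast
  obtain N where N: "local_frame B A \<iota> r Ltr U N"
    and dual: "\<forall>x\<in>U. \<forall>i<r. \<forall>j<r. g (\<iota> x) (\<xi> i x) (N j x) = (if i = j then 1 else 0) \<and>
      g (\<iota> x) (N i x) (N j x) = 0"
    using frames[rule_format, OF \<xi>] by (elim exE conjE)
  have sub: "subspace (E x)" if "subbundle B A \<iota> k E" for k E
    using that unfolding subbundle_def local_frame_def by (metis subspace_span)
  have "lightlike_splitting (g (\<iota> x)) (?T x) (?R x) (S x) (Str x) (Ltr x) r (\<lambda>i. \<xi> i x) (\<lambda>i. N i x)"
  proof
    show "bilinear (g (\<iota> x))" "g (\<iota> x) v w = g (\<iota> x) w v" for v w
      using assms(1) by (simp_all add: semi_riemannian_def)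
    show "subspace (S x)" "subspace (Str x)"
      using sub[OF bundles(2)] sub[OF bundles(3)] .
    show "?R x = ?T x \<inter> {v. \<forall>w\<in>?T x. g (\<iota> x) v w = 0}"
      by (simp add: radical_space_def normal_space_def)
    show "span ((\<lambda>i. \<xi> i x) ` {..<r}) = ?R x" "span ((\<lambda>i. N i x) ` {..<r}) = Ltr x"
      using \<xi> N U by (simp_all add: local_frame_def)
    show "span (?R x \<union> S x) = ?T x" "nondegenerate_on (g (\<iota> x)) (S x)" "?R x \<inter> S x = {0}"
      using S by blast+
    show "span (?R x \<union> Str x) = {v. \<forall>w\<in>?T x. g (\<iota> x) v w = 0}" "nondegenerate_on (g (\<iota> x)) (Str x)"
      using Str by (simp_all add: normal_space_def)
    show "g (\<iota> x) v w = 0" if "v \<in> Ltr x" "w \<in> S x \<union> Str x" for v w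
      using Ltr that by blast
    show "g (\<iota> x) (\<xi> i x) (N j x) = (if i = j then 1 else 0)" "g (\<iota> x) (N i x) (N j x) = 0"
      if "i < r" "j < r" for i j
      using dual U that by blast+
  qed
  then show ?thesis by blast
qed

section \<open>Radical screen transversal lightlike submanifolds\<close>

theorem theorem3p17:
  fixes p q r :: nat
    and A :: "('m::{t2_space,second_countable_topology}, 'e::euclidean_space) chart set"
    and g :: "'m \<Rightarrow> 'e \<Rightarrow> 'e \<Rightarrow> real"
    and J :: "'m \<Rightarrow> 'e \<Rightarrow> 'e"
    and nab :: "'m \<Rightarrow> 'e \<Rightarrow> ('m \<Rightarrow> 'e) \<Rightarrow> 'e"
    and B :: "('n::{t2_space,second_countable_topology}, 'k::euclidean_space) chart set"
    and \<iota> :: "'n \<Rightarrow> 'm"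
    and S Str Ltr :: "'n \<Rightarrow> 'e set"
  assumes "p > 0" and "q > 0"
    and "locally_metallic p q A g J nab"
    and "lightlike_submanifold B A \<iota> g r S Str Ltr"
    and "radical_screen_transversal B A \<iota> g J S Str"
  shows "radical_totally_geodesic B A \<iota> g nab Str Ltr \<longleftrightarrow>
     (\<forall>W\<in>sections B A \<iota> (radical_space B A \<iota> g). \<forall>U\<in>sections B A \<iota> (radical_space B A \<iota> g). \<forall>x.
        shape_op B A \<iota> nab Str Ltr (\<lambda>y. J (\<iota> y) (U y)) W x \<in> radical_space B A \<iota> g x \<and>
        radical_shape_op B A \<iota> g nab S Str Ltr U W x = 0) \<or>
     (\<forall>W\<in>sections B A \<iota> (radical_space B A \<iota> g). \<forall>U\<in>sections B A \<iota> (radical_space B A \<iota> g). \<forall>x.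
        shape_op B A \<iota> nab Str Ltr (\<lambda>y. J (\<iota> y) (U y)) W x =
          real p *\<^sub>R radical_shape_op B A \<iota> g nab S Str Ltr U W x) \<or>
     (\<forall>W\<in>sections B A \<iota> (radical_space B A \<iota> g). \<forall>Z\<in>sections B A \<iota> S.
        no_component_in_J_radical B A \<iota> g J
          (screen_second_ff B A \<iota> nab Str Ltr W (\<lambda>y. J (\<iota> y) (Z y))))"
  (is "?TG \<longleftrightarrow> ?i \<or> ?ii \<or> ?iii")
proof -
  let ?R = "radical_space B A \<iota> g" and ?T = "tangent_space B A \<iota>"
  let ?\<Gamma> = "sections B A \<iota> ?R" and ?D = "ambient_deriv B A \<iota> nab"
  have met: "metallic_semi_riemannian p q A g J" and lc: "levi_civita A g nab"
    and par: "\<And>x v Y. smooth_field_near A x Y \<Longrightarrow> nab x v (\<lambda>y. J y (Y y)) = J x (nab x v Y)"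
    using assms(3) unfolding locally_metallic_def by auto
  have g: "semi_riemannian A g" and lin: "\<And>x. linear (J x)"
    and smJ: "\<And>U X. open U \<Longrightarrow> smooth_field_on A U X \<Longrightarrow> smooth_field_on A U (\<lambda>x. J x (X x))"
    and JJ: "\<And>x v. J x (J x v) = real p *\<^sub>R J x v + real q *\<^sub>R v"
    and selfadj: "\<And>x v w. g x (J x v) w = g x v (J x w)"
    using met unfolding metallic_semi_riemannian_def by auto
  have at: "smooth_atlas B" "smooth_atlas A" and sm: "smooth_map B A \<iota>" and subS: "subbundle B A \<iota> (DIM('k) - r) S"
    using assms(4) unfolding lightlike_submanifold_def submanifold_def by auto
  have aff: "affine_connection A nab" using lc by (simp add: levi_civita_def)
  have JR: "J (\<iota> x) u \<in> Str x" if "u \<in> ?R x" for x u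
    using assms(5) that unfolding radical_screen_transversal_def by blast
  have JS: "J (\<iota> x) ` S x = S x" for x
    using assms(5) unfolding radical_screen_transversal_def by blast
  then have JSI: "J (\<iota> x) z \<in> S x" if "z \<in> S x" for x z using that by blast
  have sm_sec: "smooth_along B A \<iota> UNIV V" "V x \<in> E x" if "V \<in> sections B A \<iota> E" for V E x
    using that by (auto simp: sections_def)
  have DJ: "?D W (\<lambda>y. J (\<iota> y) (V y)) x = J (\<iota> x) (?D W V x)" if "smooth_along B A \<iota> UNIV V" for W V x
    unfolding ambient_deriv_def
    by (rule connection_along_parallel[where J = J and V = V, OF at sm aff lin _ _ that]) (use smJ par in blast)+
  have smJ_along: "smooth_along B A \<iota> UNIV (\<lambda>y. J (\<iota> y) (V y))" if "smooth_along B A \<iota> UNIV V" for V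
    by (rule smooth_along_tensor[where J = J and V = V, OF at sm lin _ that]) (use smJ in blast)
  \<comment> \<open>All conditions are read off from the products of the ambient derivative \<open>D\<^sub>W U\<close> with the screen.\<close>
  define P where "P W U x z = g (\<iota> x) (?D W U x) z" for W U x z
  have ops: "induced_connection B A \<iota> nab Str Ltr W U x \<in> ?R x \<longleftrightarrow> (\<forall>z\<in>S x. P W U x z = 0)"
    "radical_shape_op B A \<iota> g nab S Str Ltr U W x = 0 \<longleftrightarrow> (\<forall>z\<in>S x. P W U x z = 0)"
    "z \<in> S x \<Longrightarrow> g (\<iota> x) (radical_shape_op B A \<iota> g nab S Str Ltr U W x) z = - P W U x z"
    "shape_op B A \<iota> nab Str Ltr (\<lambda>y. J (\<iota> y) (U y)) W x \<in> ?R x \<longleftrightarrow> (\<forall>z\<in>S x. P W U x (J (\<iota> x) z) = 0)"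
    "z \<in> S x \<Longrightarrow> g (\<iota> x) (shape_op B A \<iota> nab Str Ltr (\<lambda>y. J (\<iota> y) (U y)) W x) z = - P W U x (J (\<iota> x) z)"
    if U: "U \<in> ?\<Gamma>" for W U x z
  proof -
    obtain \<xi> N where "lightlike_splitting (g (\<iota> x)) (?T x) (?R x) (S x) (Str x) (Ltr x) r \<xi> N"
      using lightlike_submanifold_splitting[OF g assms(4)] by blast
    then interpret lightlike_splitting "g (\<iota> x)" "?T x" "?R x" "S x" "Str x" "Ltr x" r \<xi> N .
    let ?C = "component (?T x) (span (Ltr x \<union> Str x))"
    have DJU: "?D W (\<lambda>y. J (\<iota> y) (U y)) x = J (\<iota> x) (?D W U x)" by (rule DJ[OF sm_sec(1)[OF U]])
    show "induced_connection B A \<iota> nab Str Ltr W U x \<in> ?R x \<longleftrightarrow> (\<forall>z\<in>S x. P W U x z = 0)"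
      unfolding induced_connection_def P_def by (simp add: mem_R_iff tangent_component)
    then show "radical_shape_op B A \<iota> g nab S Str Ltr U W x = 0 \<longleftrightarrow> (\<forall>z\<in>S x. P W U x z = 0)"
      unfolding radical_shape_op_def
      by (simp add: screen_component_eq_0_iff induced_connection_def tangent_component)
    show "g (\<iota> x) (radical_shape_op B A \<iota> g nab S Str Ltr U W x) z = - P W U x z" if "z \<in> S x"
      unfolding radical_shape_op_def induced_connection_def P_def
      using that by (simp add: screen_component tangent_component b_simps)
    have "shape_op B A \<iota> nab Str Ltr (\<lambda>y. J (\<iota> y) (U y)) W x = - ?C (J (\<iota> x) (?D W U x))"
      by (simp add: shape_op_def DJU)
    moreover have "- ?C v \<in> ?T x" for v
      using subspace_neg[OF subspace_T] tangent_component(1) by blast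
    ultimately show "shape_op B A \<iota> nab Str Ltr (\<lambda>y. J (\<iota> y) (U y)) W x \<in> ?R x
          \<longleftrightarrow> (\<forall>z\<in>S x. P W U x (J (\<iota> x) z) = 0)"
      and "z \<in> S x \<Longrightarrow> g (\<iota> x) (shape_op B A \<iota> nab Str Ltr (\<lambda>y. J (\<iota> y) (U y)) W x) z = - P W U x (J (\<iota> x) z)"
      unfolding P_def by (auto simp: mem_R_iff b_simps tangent_component selfadj)
  qed
  have TG: "?TG \<longleftrightarrow> (\<forall>W\<in>?\<Gamma>. \<forall>U\<in>?\<Gamma>. \<forall>x. \<forall>z\<in>S x. P W U x z = 0)"
    unfolding radical_totally_geodesic_def by (simp add: ops(1))
  have bilg: "bilinear (g x)" for x using g by (simp add: semi_riemannian_def)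
  then have P_lin: "P W U x (v + w) = P W U x v + P W U x w" "P W U x (a *\<^sub>R v) = a * P W U x v" for W U x v w a
    unfolding P_def by (simp_all add: bilinear_radd bilinear_rmul)
  have "?i" if ?TG
    using that JSI unfolding TG by (simp add: ops(2,4))
  moreover have ?TG if ?i
    using that unfolding TG by (simp add: ops(2))
  moreover have ?TG if ii: ?ii
    unfolding TG
  proof (intro ballI allI)
    fix W U x z assume W: "W \<in> ?\<Gamma>" and U: "U \<in> ?\<Gamma>" and z: "z \<in> S x"
    \<comment> \<open>With \<open>z' = J z\<close> one has \<open>J z' = p z' + q z\<close>, and the hypothesis removes the term \<open>p z'\<close>.\<close>
    have "g (\<iota> x) (shape_op B A \<iota> nab Str Ltr (\<lambda>y. J (\<iota> y) (U y)) W x) (J (\<iota> x) z)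
        = real p * g (\<iota> x) (radical_shape_op B A \<iota> g nab S Str Ltr U W x) (J (\<iota> x) z)"
      using ii W U by (simp add: bilinear_lmul[OF bilg])
    then have "P W U x (J (\<iota> x) (J (\<iota> x) z)) = real p * P W U x (J (\<iota> x) z)"
      using ops(3,5)[OF U JSI[OF z]] by simp
    then have "real q * P W U x z = 0" by (simp add: JJ P_lin)
    then show "P W U x z = 0" using assms(2) by simp
  qed
  moreover have ?TG if iii: ?iii
    unfolding TG
  proof (intro ballI allI)
    fix W U x z' assume W: "W \<in> ?\<Gamma>" and U: "U \<in> ?\<Gamma>" and "z' \<in> S x"
    \<comment> \<open>\<open>z'\<close> is extended to a global section in the form \<open>J (J Z)\<close>.\<close>
    then obtain z where z: "z \<in> S x" "z' = J (\<iota> x) (J (\<iota> x) z)" using JS[of x] by (metis imageE)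
    obtain Z where Z: "Z \<in> sections B A \<iota> S" "Z x = z"
      using section_through_vector[OF at smooth_map_continuous[OF sm] subS z(1)] .
    let ?JZ = "\<lambda>y. J (\<iota> y) (Z y)" and ?JU = "\<lambda>y. J (\<iota> y) (U y)"
    have splitting: "\<exists>\<xi> N. lightlike_splitting (g (\<iota> y)) (?T y) (?R y) (S y) (Str y) (Ltr y) r \<xi> N" for y
      by (rule lightlike_submanifold_splitting[OF g assms(4)])
    have orth: "g (\<iota> y) (?JZ y) (?JU y) = 0" for y
    proof -
      obtain \<xi> N where "lightlike_splitting (g (\<iota> y)) (?T y) (?R y) (S y) (Str y) (Ltr y) r \<xi> N"
        using splitting by blast
      then interpret lightlike_splitting "g (\<iota> y)" "?T y" "?R y" "S y" "Str y" "Ltr y" r \<xi> N .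
      have "g (\<iota> y) (?JU y) (?JZ y) = 0"
        using Q_orth JR[OF sm_sec(2)[OF U]] JSI[OF sm_sec(2)[OF Z(1)]] S_sub_T by blast
      then show ?thesis by (simp add: sym)
    qed
    have "g (\<iota> x) (?D W ?JZ x) (?JU x) + g (\<iota> x) (?JZ x) (?D W ?JU x) = 0"
      unfolding ambient_deriv_def
      by (rule connection_along_orthogonal[OF at sm g lc smJ_along smJ_along orth])
         (use sm_sec(1) U Z(1) in auto)
    moreover have "g (\<iota> x) (?D W ?JZ x) (?JU x) = 0"
    proof -
      obtain \<xi> N where "lightlike_splitting (g (\<iota> x)) (?T x) (?R x) (S x) (Str x) (Ltr x) r \<xi> N"
        using splitting by blast
      then interpret lightlike_splitting "g (\<iota> x)" "?T x" "?R x" "S x" "Str x" "Ltr x" r \<xi> N .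
      have "g (\<iota> x) (screen_second_ff B A \<iota> nab Str Ltr W ?JZ x) (?JU x) = 0"
        using iii W U Z(1) unfolding no_component_in_J_radical_def by blast
      then show ?thesis
        using screen_transversal_component[OF JR[OF sm_sec(2)[OF U]]] by (simp add: screen_second_ff_def)
    qed
    ultimately have "g (\<iota> x) (?JZ x) (J (\<iota> x) (?D W U x)) = 0"
      using DJ[OF sm_sec(1)[OF U]] by simp
    then show "P W U x z' = 0"
      using g Z(2) unfolding P_def z(2) semi_riemannian_def by (metis selfadj)
  qed
  ultimately show ?thesis by blast
qed

end
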